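(* Let $T\subset\mathbb{R}^3$ be a convex polyhedron satisfying the assumptions in the context, with set of faces $\mathcal{F}$, and let $\mathcal{M}\Lambda^2(T)$ be the space defined in the context. Then there exists a computable basis $\{\mathbf{q}_f,\ f\in\mathcal{F}\}$ for $\mathcal{M}\Lambda^2(T)$ such that on each $f'\in\mathcal{F}$, $$\mathbf{q}_f\cdot\mathbf{n}_{f'}|_{f'}=\begin{cases}1 & \text{if } f=f',\\ 0&\text{otherwise.}\end{cases}$$ Therefore the dimension of $\mathcal{M}\Lambda^2(T)$ is equal to the number of faces of $T$.
   Context: $T\subset\mathbb{R}^3$ is a (closed) convex polyhedron with vertices $\mathbf{v}_1,\dots,\mathbf{v}_n$. Generalized barycentric coordinates on $T$ are functions $\lambda_1,\dots,\lambda_n$ on $T$, non-negative, with $L(\mathbf{x})=\sum_i L(\mathbf{v}_i)\lambda_i(\mathbf{x})$ for every affine $L$ and all $\mathbf{x}\in T$. Assumption 1: $\lambda_i(\mathbf{v}_j)=\delta_{ij}$; $\lambda_i\in C^1(T)$ (up to the boundary); on each face $f$, the $\lambda_i$ with $\mathbf{v}_i\in f$ restrict to 2D generalized barycentric coordinates of the polygon $f$ which again satisfy the Lagrange property, are $C^1$ on $f$ and are linear on each edge of $f$, while $\lambda_i|_f=0$ if $\mathbf{v}_i\notin f$. Assumption 2: every face $f$ is a triangle or a parallelogram, and if its vertices are $\mathbf{v}_{i_1},\mathbf{v}_{i_2},\dots$ in counterclockwise order seen from outside $T$, $D_{ab}:=(\nabla\lambda_{i_a}\times\nabla\lambda_{i_b})\cdot\mathbf{n}_f|_f$,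 and $|f|$ is the area, then $D_{12}=D_{23}=D_{31}=\frac1{2|f|}$ for a triangle, and $D_{12}+D_{34}=D_{23}+D_{41}=\frac1{|f|}$ for a parallelogram. Here $\mathbf{n}_f$ is the unit outward normal on $f$. Whitney 1-forms: $W_{ij}=\lambda_i\nabla\lambda_j-\lambda_j\nabla\lambda_i$; $\mathrm{curl}\,W_{ij}=2\nabla\lambda_i\times\nabla\lambda_j$. For $i\ne j$, $e_{ij}$ is the directed segment from $\mathbf{v}_i$ to $\mathbf{v}_j$ and $\boldsymbol{\tau}_{ij}=\mathbf{v}_j-\mathbf{v}_i$. $\mathcal{E}$ is the set of $e_{ij}$ that are edges of $T$ (both directions included), $\mathcal{E}_F$ the set of $e_{ij}$ lying on $\partial T$ but not in $\mathcal{E}$, $\mathcal{E}_I$ the set of remaining $e_{ij}$ (not lying on $\partial T$). For $e_{ij}\in\mathcal{E}$, $\mathcal{V}_{ij}$ is the set of all vertices of the two faces sharing $e_{ij}$. For each $e_{ik}\in\mathcal{E}_I$ fix once and for all coefficients $C^{ik}_{ij}$ with $\boldsymbol{\tau}_{ik}=\sum_{j,\,e_{ij}\in\mathcal{E}}C^{ik}_{ij}\boldsymbol{\tau}_{ij}$. For $e_{ij}\in\mathcal{E}$ define $$\tilde W_{ij}=W_{ij}+\tfrac12\Big(\sum_{\mathbf{v}_k\in\mathcal{V}_{ij},\,e_{ik}\in\mathcal{E}_F}W_{ik}-\sum_{\mathbf{v}_k\in\mathcal{V}_{ij},\,e_{jk}\in\mathcal{E}_F}W_{jk}\Big)+\tfrac12\Big(\sum_{k,\,e_{ik}\in\mathcal{E}_I}C^{ik}_{ij}W_{ik}-\sum_{k,\,e_{jk}\in\mathcal{E}_I}C^{jk}_{ji}W_{jk}\Big).$$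 $\mathcal{F}$ is the set of faces of $T$; $\partial f$ is the boundary of $f$ oriented by the right-hand rule with $\mathbf{n}_f$; $e_{ij}\in\partial f$ means that $e_{ij}$ is an edge of $f$ directed according to this orientation. Define $\tilde W_f=\sum_{e_{ij}\in\partial f}\tilde W_{ij}$ and, for a fixed point $\mathbf{x}_*$ in the interior of $T$, $$\mathcal{M}\Lambda^2(T)=\mathrm{span}\{\mathrm{curl}\,\tilde W_f,\ f\in\mathcal{F}\}+\mathrm{span}\{\mathbf{x}-\mathbf{x}_*\}.$$ "Computable" means that each $\mathbf{q}_f$ can be written as a linear combination of $\mathbf{x}-\mathbf{x}_*$ and the $\mathrm{curl}\,\tilde W_{\tilde f}$, $\tilde f\in\mathcal{F}$, with coefficients obtained by solving an explicit finite linear system. *)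

theory Defs
  imports "HOL-Analysis.Analysis" "HOL-Library.Function_Algebras"
begin

section \<open>Vector spaces of functions\<close>

instantiation "fun" :: (type, real_vector) real_vector
begin

definition scaleR_fun_def: "c *\<^sub>R f = (\<lambda>x. c *\<^sub>R f x)"

instance
  by standard (simp_all add: scaleR_fun_def fun_eq_iff algebra_simps)

end


section \<open>Gradient and curl\<close>

text \<open>When \<open>S\<close> is convex with nonempty interior, the derivative relative to \<open>S\<close> is unique
  also at boundary points, and \<open>C1_on S f\<close> says that \<open>f\<close> is continuously differentiable up to the
  boundary. When \<open>S\<close> is a planar polygon, only the tangential part of \<open>g\<close> is determined
  by \<open>f\<close>, and \<open>C1_on S f\<close> is two-dimensional continuous differentiability.\<close>

definition C1_on :: "(real^3) set \<Rightarrow> (real^3 \<Rightarrow> real) \<Rightarrow> bool" where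
  "C1_on S f \<longleftrightarrow>
     (\<exists>g. continuous_on S g \<and>
          (\<forall>x\<in>S. (f has_derivative (\<lambda>h. g x \<bullet> h)) (at x within S)))"

definition grad :: "(real^3) set \<Rightarrow> (real^3 \<Rightarrow> real) \<Rightarrow> real^3 \<Rightarrow> real^3" where
  "grad S f x = (THE g. (f has_derivative (\<lambda>h. g \<bullet> h)) (at x within S))"

definition classical_curl :: "(real^3 \<Rightarrow> real^3) \<Rightarrow> real^3 \<Rightarrow> real^3" where
  "classical_curl F x =
     (let J = jacobian F (at x)
      in vector [J $ 3 $ 2 - J $ 2 $ 3, J $ 1 $ 3 - J $ 3 $ 1, J $ 2 $ 1 - J $ 1 $ 2])"

definition test_field :: "(real^3) set \<Rightarrow> (real^3 \<Rightarrow> real^3) \<Rightarrow> bool" where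
  "test_field S \<phi> \<longleftrightarrow>
     (\<forall>k. C1_on UNIV (\<lambda>x. \<phi> x $ k)) \<and>
     (\<exists>K. compact K \<and> K \<subseteq> interior S \<and> (\<forall>x. x \<notin> K \<longrightarrow> \<phi> x = 0))"

definition weak_curl_on ::
    "(real^3) set \<Rightarrow> (real^3 \<Rightarrow> real^3) \<Rightarrow> (real^3 \<Rightarrow> real^3) \<Rightarrow> bool" where
  "weak_curl_on S u w \<longleftrightarrow>
     (\<forall>\<phi>. test_field S \<phi> \<longrightarrow>
        integral S (\<lambda>x. u x \<bullet> classical_curl \<phi> x) = integral S (\<lambda>x. w x \<bullet> \<phi> x))"

text \<open>The coordinates \<open>\<lambda>\<^sub>i\<close> are only continuously differentiable, so the forms
  \<open>\<lambda>\<^sub>i \<nabla>\<lambda>\<^sub>j - \<lambda>\<^sub>j \<nabla>\<lambda>\<^sub>i\<close> are in general merely continuous and their curl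
  \<open>2 \<nabla>\<lambda>\<^sub>i \<times> \<nabla>\<lambda>\<^sub>j\<close> is the distributional one. (For continuous fields, testing with continuously
  differentiable or with smooth compactly supported fields is the same.)
  Its representative continuous up to the boundary is unique on the closure of the interior.
  A vector field on \<open>S\<close> is represented by a function that is zero off \<open>S\<close>, so that equality
  of fields is equality on \<open>S\<close>.\<close>

definition curl :: "(real^3) set \<Rightarrow> (real^3 \<Rightarrow> real^3) \<Rightarrow> real^3 \<Rightarrow> real^3" where
  "curl S u =
     (THE w. continuous_on S w \<and> (\<forall>x. x \<notin> S \<longrightarrow> w x = 0) \<and> weak_curl_on S u w)"


section \<open>Faces, edges, orientation\<close>

definition faces :: "(real^3) set \<Rightarrow> (real^3) set set" where
  "faces T = {f. f facet_of T}"

text \<open>Taking both \<open>x\<close> and \<open>y\<close> in \<open>f\<close> shows that \<open>m\<close> is orthogonal to \<open>f\<close>.\<close>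

definition normal :: "(real^3) set \<Rightarrow> (real^3) set \<Rightarrow> real^3" where
  "normal T f = (THE m. norm m = 1 \<and> (\<forall>x\<in>f. \<forall>y\<in>T. m \<bullet> y \<le> m \<bullet> x))"

text \<open>The area of a planar face is the volume of the right prism of height one over it.\<close>

definition area :: "(real^3) set \<Rightarrow> (real^3) set \<Rightarrow> real" where
  "area T f = measure lebesgue {x + t *\<^sub>R normal T f | x t. x \<in> f \<and> 0 \<le> t \<and> t \<le> 1}"

text \<open>Vertices are numbered \<open>v 1, \<dots>, v n\<close>; the directed segment \<open>e\<^sub>i\<^sub>j\<close> is represented by \<open>(i, j)\<close>.\<close>

definition seg :: "(nat \<Rightarrow> real^3) \<Rightarrow> nat \<Rightarrow> nat \<Rightarrow> (real^3) set" where
  "seg v i j = closed_segment (v i) (v j)"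

definition all_pairs :: "nat \<Rightarrow> (nat \<times> nat) set" where
  "all_pairs n = {(i, j). i \<in> {1..n} \<and> j \<in> {1..n} \<and> i \<noteq> j}"

definition edges :: "(real^3) set \<Rightarrow> nat \<Rightarrow> (nat \<Rightarrow> real^3) \<Rightarrow> (nat \<times> nat) set" where
  "edges T n v = {(i, j) \<in> all_pairs n. seg v i j edge_of T}"

definition face_diagonals :: "(real^3) set \<Rightarrow> nat \<Rightarrow> (nat \<Rightarrow> real^3) \<Rightarrow> (nat \<times> nat) set" where
  "face_diagonals T n v = {(i, j) \<in> all_pairs n. seg v i j \<subseteq> frontier T} - edges T n v"

definition inner_diagonals :: "(real^3) set \<Rightarrow> nat \<Rightarrow> (nat \<Rightarrow> real^3) \<Rightarrow> (nat \<times> nat) set" where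
  "inner_diagonals T n v = all_pairs n - edges T n v - face_diagonals T n v"

definition adjacent_vertices ::
    "(real^3) set \<Rightarrow> nat \<Rightarrow> (nat \<Rightarrow> real^3) \<Rightarrow> nat \<Rightarrow> nat \<Rightarrow> nat set" where
  "adjacent_vertices T n v i j =
     {k \<in> {1..n}. \<exists>f\<in>faces T. seg v i j edge_of f \<and> v k \<in> f}"

text \<open>Right-hand rule: going along \<open>e\<^sub>i\<^sub>j\<close> with the outward normal pointing up,
  the face lies on the left.\<close>

definition oriented_boundary ::
    "(real^3) set \<Rightarrow> nat \<Rightarrow> (nat \<Rightarrow> real^3) \<Rightarrow> (real^3) set \<Rightarrow> (nat \<times> nat) set" where
  "oriented_boundary T n v f =
     {(i, j) \<in> all_pairs n. seg v i j edge_of f \<and>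
        (\<forall>x\<in>f. 0 \<le> cross3 (v j - v i) (x - v i) \<bullet> normal T f)}"

definition ccw_triangle ::
    "(real^3) set \<Rightarrow> (real^3) set \<Rightarrow> real^3 \<Rightarrow> real^3 \<Rightarrow> real^3 \<Rightarrow> bool" where
  "ccw_triangle T f a b c \<longleftrightarrow>
     f = convex hull {a, b, c} \<and> 0 < cross3 (b - a) (c - a) \<bullet> normal T f"

definition ccw_parallelogram ::
    "(real^3) set \<Rightarrow> (real^3) set \<Rightarrow> real^3 \<Rightarrow> real^3 \<Rightarrow> real^3 \<Rightarrow> real^3 \<Rightarrow> bool" where
  "ccw_parallelogram T f a b c d \<longleftrightarrow>
     f = convex hull {a, b, c, d} \<and> b - a = c - d \<and> 0 < cross3 (b - a) (d - a) \<bullet> normal T f"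


section \<open>Generalized barycentric coordinates\<close>

definition affine_function :: "(real^3 \<Rightarrow> real) \<Rightarrow> bool" where
  "affine_function L \<longleftrightarrow> (\<exists>l c. linear l \<and> (\<forall>x. L x = l x + c))"

text \<open>For a face \<open>P\<close>, the affine functions on its plane are the restrictions of affine functions
  on the space.\<close>

definition barycentric_coords ::
    "(real^3) set \<Rightarrow> nat set \<Rightarrow> (nat \<Rightarrow> real^3) \<Rightarrow> (nat \<Rightarrow> real^3 \<Rightarrow> real) \<Rightarrow> bool" where
  "barycentric_coords P I v lam \<longleftrightarrow>
     (\<forall>i\<in>I. \<forall>x\<in>P. 0 \<le> lam i x) \<and>
     (\<forall>L. affine_function L \<longrightarrow> (\<forall>x\<in>P. L x = (\<Sum>i\<in>I. L (v i) * lam i x)))"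

definition lagrange_property ::
    "nat set \<Rightarrow> (nat \<Rightarrow> real^3) \<Rightarrow> (nat \<Rightarrow> real^3 \<Rightarrow> real) \<Rightarrow> bool" where
  "lagrange_property I v lam \<longleftrightarrow> (\<forall>i\<in>I. \<forall>j\<in>I. lam i (v j) = (if i = j then 1 else 0))"

definition coords_regular ::
    "(real^3) set \<Rightarrow> nat \<Rightarrow> (nat \<Rightarrow> real^3) \<Rightarrow> (nat \<Rightarrow> real^3 \<Rightarrow> real) \<Rightarrow> bool" where
  "coords_regular T n v lam \<longleftrightarrow>
     lagrange_property {1..n} v lam \<and>
     (\<forall>i\<in>{1..n}. C1_on T (lam i)) \<and>
     (\<forall>f\<in>faces T.
        let I = {i \<in> {1..n}. v i \<in> f} in
          barycentric_coords f I v lam \<and>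
          lagrange_property I v lam \<and>
          (\<forall>i\<in>I. C1_on f (lam i) \<and>
             (\<forall>e. e edge_of f \<longrightarrow> (\<exists>L. affine_function L \<and> (\<forall>x\<in>e. lam i x = L x)))) \<and>
          (\<forall>i\<in>{1..n} - I. \<forall>x\<in>f. lam i x = 0))"

definition face_jacobian ::
    "(real^3) set \<Rightarrow> (nat \<Rightarrow> real^3 \<Rightarrow> real) \<Rightarrow> (real^3) set \<Rightarrow> nat \<Rightarrow> nat \<Rightarrow> real^3 \<Rightarrow> real" where
  "face_jacobian T lam f i j x = cross3 (grad T (lam i) x) (grad T (lam j) x) \<bullet> normal T f"

definition faces_regular ::
    "(real^3) set \<Rightarrow> nat \<Rightarrow> (nat \<Rightarrow> real^3) \<Rightarrow> (nat \<Rightarrow> real^3 \<Rightarrow> real) \<Rightarrow> bool" where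
  "faces_regular T n v lam \<longleftrightarrow>
     (\<forall>f\<in>faces T.
        let D = face_jacobian T lam f in
          ((\<exists>i\<in>{1..n}. \<exists>j\<in>{1..n}. \<exists>k\<in>{1..n}. ccw_triangle T f (v i) (v j) (v k)) \<or>
           (\<exists>i\<in>{1..n}. \<exists>j\<in>{1..n}. \<exists>k\<in>{1..n}. \<exists>l\<in>{1..n}.
              ccw_parallelogram T f (v i) (v j) (v k) (v l))) \<and>
          (\<forall>i\<in>{1..n}. \<forall>j\<in>{1..n}. \<forall>k\<in>{1..n}.
             ccw_triangle T f (v i) (v j) (v k) \<longrightarrow>
             (\<forall>x\<in>f. D i j x = 1 / (2 * area T f) \<and>
                    D j k x = 1 / (2 * area T f) \<and>
                    D k i x = 1 / (2 * area T f))) \<and>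
          (\<forall>i\<in>{1..n}. \<forall>j\<in>{1..n}. \<forall>k\<in>{1..n}. \<forall>l\<in>{1..n}.
             ccw_parallelogram T f (v i) (v j) (v k) (v l) \<longrightarrow>
             (\<forall>x\<in>f. D i j x + D k l x = 1 / area T f \<and>
                    D j k x + D l i x = 1 / area T f)))"


section \<open>Whitney forms and the face space\<close>

definition whitney ::
    "(real^3) set \<Rightarrow> (nat \<Rightarrow> real^3 \<Rightarrow> real) \<Rightarrow> nat \<Rightarrow> nat \<Rightarrow> real^3 \<Rightarrow> real^3" where
  "whitney T lam i j x = lam i x *\<^sub>R grad T (lam j) x - lam j x *\<^sub>R grad T (lam i) x"

text \<open>\<open>C i k j\<close> stands for the coefficient \<open>C\<close> with upper index \<open>ik\<close> and lower index \<open>ij\<close>.\<close>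

definition inner_diagonal_coeffs ::
    "(real^3) set \<Rightarrow> nat \<Rightarrow> (nat \<Rightarrow> real^3) \<Rightarrow> (nat \<Rightarrow> nat \<Rightarrow> nat \<Rightarrow> real) \<Rightarrow> bool" where
  "inner_diagonal_coeffs T n v C \<longleftrightarrow>
     (\<forall>(i, k) \<in> inner_diagonals T n v.
        v k - v i = (\<Sum>j | (i, j) \<in> edges T n v. C i k j *\<^sub>R (v j - v i)))"

definition whitney_tilde ::
    "(real^3) set \<Rightarrow> nat \<Rightarrow> (nat \<Rightarrow> real^3) \<Rightarrow> (nat \<Rightarrow> real^3 \<Rightarrow> real) \<Rightarrow>
     (nat \<Rightarrow> nat \<Rightarrow> nat \<Rightarrow> real) \<Rightarrow> nat \<Rightarrow> nat \<Rightarrow> real^3 \<Rightarrow> real^3" where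
  "whitney_tilde T n v lam C i j =
     (let W = whitney T lam;
          V = adjacent_vertices T n v i j;
          EF = face_diagonals T n v;
          EI = inner_diagonals T n v
      in W i j
         + (1/2) *\<^sub>R ((\<Sum>k | k \<in> V \<and> (i, k) \<in> EF. W i k) - (\<Sum>k | k \<in> V \<and> (j, k) \<in> EF. W j k))
         + (1/2) *\<^sub>R ((\<Sum>k | (i, k) \<in> EI. C i k j *\<^sub>R W i k)
                     - (\<Sum>k | (j, k) \<in> EI. C j k i *\<^sub>R W j k)))"

definition whitney_face ::
    "(real^3) set \<Rightarrow> nat \<Rightarrow> (nat \<Rightarrow> real^3) \<Rightarrow> (nat \<Rightarrow> real^3 \<Rightarrow> real) \<Rightarrow>
     (nat \<Rightarrow> nat \<Rightarrow> nat \<Rightarrow> real) \<Rightarrow> (real^3) set \<Rightarrow> real^3 \<Rightarrow> real^3" where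
  "whitney_face T n v lam C f =
     (\<Sum>(i, j) \<in> oriented_boundary T n v f. whitney_tilde T n v lam C i j)"

definition radial_field :: "(real^3) set \<Rightarrow> real^3 \<Rightarrow> real^3 \<Rightarrow> real^3" where
  "radial_field T xs x = (if x \<in> T then x - xs else 0)"

definition M_Lambda2 ::
    "(real^3) set \<Rightarrow> nat \<Rightarrow> (nat \<Rightarrow> real^3) \<Rightarrow> (nat \<Rightarrow> real^3 \<Rightarrow> real) \<Rightarrow>
     (nat \<Rightarrow> nat \<Rightarrow> nat \<Rightarrow> real) \<Rightarrow> real^3 \<Rightarrow> (real^3 \<Rightarrow> real^3) set" where
  "M_Lambda2 T n v lam C xs =
     {p + r | p r. p \<in> span ((\<lambda>f. curl T (whitney_face T n v lam C f)) ` faces T) \<and>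
                   r \<in> span {radial_field T xs}}"


section \<open>Computability of the basis\<close>

definition face_combination ::
    "(real^3) set \<Rightarrow> nat \<Rightarrow> (nat \<Rightarrow> real^3) \<Rightarrow> (nat \<Rightarrow> real^3 \<Rightarrow> real) \<Rightarrow>
     (nat \<Rightarrow> nat \<Rightarrow> nat \<Rightarrow> real) \<Rightarrow> real^3 \<Rightarrow> real \<Rightarrow> ((real^3) set \<Rightarrow> real) \<Rightarrow> real^3 \<Rightarrow> real^3" where
  "face_combination T n v lam C xs a c =
     a *\<^sub>R radial_field T xs + (\<Sum>g\<in>faces T. c g *\<^sub>R curl T (whitney_face T n v lam C g))"

text \<open>The (constant) value of \<open>curl T (whitney_face T n v lam C g) \<bullet> normal T f'\<close> on the face \<open>f'\<close>:
  every edge of \<open>f'\<close> contributes \<open>1 / area\<close>, with a negative sign if it is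
  traversed by the boundary of another face \<open>g\<close>.\<close>

definition face_matrix :: "(real^3) set \<Rightarrow> (real^3) set \<Rightarrow> (real^3) set \<Rightarrow> real" where
  "face_matrix T f' g =
     (if g = f' then real (card {e. e edge_of f'})
      else - real (card {e. e edge_of f' \<and> e edge_of g})) / area T f'"

text \<open>A finite linear system for \<open>a\<close> and the \<open>c g\<close>, determined by the geometry of \<open>T\<close> alone. There is
  one equation for each face \<open>f'\<close> and each of its vertices; those for the same \<open>f'\<close> coincide, since
  \<open>(x - xs) \<bullet> normal T f'\<close> is constant on \<open>f'\<close>.\<close>

definition face_system ::
    "(real^3) set \<Rightarrow> nat \<Rightarrow> (nat \<Rightarrow> real^3) \<Rightarrow> real^3 \<Rightarrow>
     (real^3) set \<Rightarrow> real \<Rightarrow> ((real^3) set \<Rightarrow> real) \<Rightarrow> bool" where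
  "face_system T n v xs f a c \<longleftrightarrow>
     (\<forall>f'\<in>faces T. \<forall>i\<in>{1..n}. v i \<in> f' \<longrightarrow>
        a * ((v i - xs) \<bullet> normal T f') + (\<Sum>g\<in>faces T. c g * face_matrix T f' g)
          = (if f = f' then 1 else 0))"

end

theory Submission
  imports Defs
begin

text \<open>Since \<open>\<lambda>\<^sub>i\<close> vanishes on the faces not containing \<open>v\<^sub>i\<close>, its gradient is normal there, so the
  normal traces of the curls on a face only see the vertices of that face. The identities for the
  \<open>D\<^sub>a\<^sub>b\<close> together with \<open>\<Sum> \<nabla>\<lambda>\<^sub>i = 0\<close> then make the trace of the curl of the corrected form of \<open>e\<^sub>i\<^sub>j\<close>
  equal to \<open>\<plusminus>1 / area\<close> if \<open>e\<^sub>i\<^sub>j\<close> is an edge of the face, with the sign of its direction, and to \<open>0\<close>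
  otherwise. Thus, up to the areas, the traces of the face fields form the Laplacian of the graph of
  faces. This graph is connected, because the frontier of a polytope stays connected without the
  vertices, so the kernel consists of the constants; and the sum of all face fields vanishes, because
  every edge is traversed once in each direction. The column sums of the Laplacian are zero, while
  \<open>x - x\<^sub>*\<close> has positive flux through every face; hence \<open>x - x\<^sub>*\<close> supplies exactly the missing
  dimension.\<close>

section \<open>The distributional curl of Whitney forms\<close>

text \<open>Since the \<open>lam i\<close> are only C1, their Whitney forms have curls merely in the
  distributional sense. \<open>curl\<close> is a definite description, so it says nothing until a
  continuous weak curl is known to exist and to be unique. Existence reduces to the symmetry of
  mixed weak partial derivatives of a C1 function; uniqueness comes from bump test fields and the
  density of the interior in \<open>T\<close>.

  The linear system has one unknown more than there are faces. Its solutions differ by a constant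
  added to all \<open>c g\<close>, which changes no field because the face fields add up to zero in
  all of \<open>T\<close>, not only in their traces. Hence zero normal traces force the field itself
  to be zero, every member of the space is the interpolant of its traces, and all solutions of the
  system yield the same basis field.\<close>

lemma has_derivative_along_segment:
  fixes f :: "'a::real_inner \<Rightarrow> real"
  assumes "convex S" "x \<in> S" "y \<in> S" "(f has_derivative (\<lambda>h. g \<bullet> h)) (at x within S)"
  shows "((\<lambda>t. f (x + t *\<^sub>R (y - x))) has_vector_derivative (g \<bullet> (y - x))) (at 0 within {0..1})"
proof -
  let ?c = "\<lambda>t::real. x + t *\<^sub>R (y - x)"
  have "?c t \<in> S" if "t \<in> {0..1}" for t
    using convexD_alt[OF assms(1-3), of t] that by (simp add: algebra_simps)
  then have "?c ` {0..1} \<subseteq> S" by auto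
  then have "(f has_derivative (\<lambda>h. g \<bullet> h)) (at (?c 0) within ?c ` {0..1})"
    using assms(4) by (auto intro: has_derivative_subset)
  moreover have "(?c has_derivative (\<lambda>t. t *\<^sub>R (y - x))) (at 0 within {0..1})"
    by (auto intro!: derivative_eq_intros)
  ultimately have "((\<lambda>t. f (?c t)) has_derivative (\<lambda>t. g \<bullet> (t *\<^sub>R (y - x)))) (at 0 within {0..1})"
    by (rule has_derivative_in_compose[rotated])
  then show ?thesis
    by (simp add: has_vector_derivative_def)
qed

text \<open>Along the segment from \<open>x\<close> to \<open>y\<close>, which convexity keeps in
  \<open>S\<close>, both sides are the one-sided derivative of \<open>f\<close> at the start. This
  covers boundary points and flat sets, where only the part of \<open>g\<close> tangent to
  \<open>S\<close> is determined.\<close>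

lemma has_derivative_within_convex_unique:
  fixes f :: "'a::real_inner \<Rightarrow> real"
  assumes "convex S" "x \<in> S" "y \<in> S" "(f has_derivative (\<lambda>h. g \<bullet> h)) (at x within S)"
    "(f has_derivative (\<lambda>h. g' \<bullet> h)) (at x within S)"
  shows "g \<bullet> (y - x) = g' \<bullet> (y - x)"
  using has_derivative_along_segment[OF assms(1-4)]
    has_derivative_along_segment[OF assms(1-3,5)]
  by (rule vector_derivative_unique_within[rotated])
    (simp add: trivial_limit_within islimpt_Icc)

lemma orthogonal_to_body:
  fixes w :: "'a::real_inner"
  assumes "interior S \<noteq> {}" "\<And>y. y \<in> S \<Longrightarrow> w \<bullet> y = c"
  shows "w = 0"
proof -
  obtain p e where e: "e > 0" "ball p e \<subseteq> S"
    using assms(1) by (meson equals0I mem_interior)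
  \<comment> \<open>Small enough to stay in the ball when moving from \<open>p\<close> along
    \<open>w\<close>; the \<open>1\<close> keeps the quotient meaningful for
    \<open>w = 0\<close>.\<close>
  define t where "t = e / (2 * (norm w + 1))"
  have np: "0 < norm w + 1" using norm_ge_zero[of w] by linarith
  have t: "t > 0" unfolding t_def using e np by simp
  have "t * norm w < e"
  proof -
    have "t * norm w \<le> t * (norm w + 1)" using t by simp
    also have "\<dots> = e / 2" using np by (simp add: t_def field_simps)
    finally show ?thesis using e by simp
  qed
  then have "p + t *\<^sub>R w \<in> S" "p \<in> S"
    using e t by (auto simp: dist_norm intro!: set_mp[OF e(2)])
  then have "w \<bullet> (t *\<^sub>R w) = 0" using assms(2)
    by (metis add_diff_cancel_left' diff_self inner_diff_right)
  then show ?thesis using t by simp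
qed

lemma grad_eqI:
  assumes "convex S" "interior S \<noteq> {}" "x \<in> S" "(f has_derivative (\<lambda>h. g \<bullet> h)) (at x within S)"
  shows "grad S f x = g"
  unfolding grad_def
proof (rule the_equality)
  show "(f has_derivative (\<lambda>h. g \<bullet> h)) (at x within S)" by fact
  fix g' assume g': "(f has_derivative (\<lambda>h. g' \<bullet> h)) (at x within S)"
  then have "(g' - g) \<bullet> y = (g' - g) \<bullet> x" if "y \<in> S" for y
    using has_derivative_within_convex_unique[OF assms(1,3) that g' assms(4)]
    by (simp add: algebra_simps)
  from orthogonal_to_body[OF assms(2) this] show "g' = g" by simp
qed

lemma C1_on_grad:
  assumes "convex S" "interior S \<noteq> {}" "C1_on S f"
  shows has_derivative_grad: "x \<in> S \<Longrightarrow> (f has_derivative (\<lambda>h. grad S f x \<bullet> h)) (at x within S)"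
    and continuous_on_grad: "continuous_on S (grad S f)"
proof -
  obtain g where g: "continuous_on S g" "\<And>x. x \<in> S \<Longrightarrow> (f has_derivative (\<lambda>h. g x \<bullet> h)) (at x within S)"
    using assms(3) by (auto simp: C1_on_def)
  have eq: "grad S f x = g x" if "x \<in> S" for x
    using grad_eqI[OF assms(1,2) that g(2)[OF that]] .
  show "x \<in> S \<Longrightarrow> (f has_derivative (\<lambda>h. grad S f x \<bullet> h)) (at x within S)"
    using g(2) eq by simp
  show "continuous_on S (grad S f)"
    using g(1) eq by (simp cong: continuous_on_cong)
qed

lemma C1_on_continuous: "C1_on S f \<Longrightarrow> continuous_on S f"
  unfolding C1_on_def
  by (metis has_derivative_continuous continuous_on_eq_continuous_within)

section \<open>Mixed weak partial derivatives of a C1 function\<close>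

lemma lborel_translate:
  fixes f :: "'a::euclidean_space \<Rightarrow> real"
  assumes "f \<in> borel_measurable borel"
  shows integrable_lborel_translate: "integrable lborel (\<lambda>x. f (c + x)) \<longleftrightarrow> integrable lborel f"
    and integral_lborel_translate: "integral\<^sup>L lborel (\<lambda>x. f (c + x)) = integral\<^sup>L lborel f"
proof -
  show "integrable lborel (\<lambda>x. f (c + x)) \<longleftrightarrow> integrable lborel f"
    using integrable_distr_eq[of "(+) c" lborel borel f] assms by (simp add: lborel_distr_plus)
  show "integral\<^sup>L lborel (\<lambda>x. f (c + x)) = integral\<^sup>L lborel f"
    using integral_distr[of "(+) c" lborel borel f] assms by (simp add: lborel_distr_plus)
qed

lemma difference_quotient_tendsto:
  fixes f :: "'a::real_inner \<Rightarrow> real"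
  assumes "(f has_derivative (\<lambda>h. g \<bullet> h)) (at x)" "\<And>m::nat. h m \<noteq> 0" "h \<longlonglongrightarrow> 0"
  shows "(\<lambda>m. (f (x + h m *\<^sub>R a) - f x) / h m) \<longlonglongrightarrow> g \<bullet> a"
proof -
  have "((\<lambda>t. x + t *\<^sub>R a) has_derivative (\<lambda>t. t *\<^sub>R a)) (at 0)"
    by (auto intro!: derivative_eq_intros)
  from has_derivative_compose[OF this, of f "\<lambda>h. g \<bullet> h"] assms(1)
  have "((\<lambda>t. f (x + t *\<^sub>R a)) has_real_derivative (g \<bullet> a)) (at 0)"
    by (simp add: has_field_derivative_def mult.commute[of _ "g \<bullet> a"])
  then have "((\<lambda>t. (f (x + t *\<^sub>R a) - f x) / t) \<longlongrightarrow> g \<bullet> a) (at 0)"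
    by (simp add: has_field_derivative_iff)
  moreover have "filterlim h (at 0) sequentially"
    using assms(2,3) by (simp add: filterlim_at)
  ultimately show ?thesis
    by (rule filterlim_compose)
qed

lemma lipschitz_of_gradient_bound:
  fixes f :: "'a::real_inner \<Rightarrow> real"
  assumes "convex S" "\<And>x. x \<in> S \<Longrightarrow> (f has_derivative (\<lambda>h. g x \<bullet> h)) (at x within S)"
    "\<And>x. x \<in> S \<Longrightarrow> norm (g x) \<le> M" "x \<in> S" "y \<in> S"
  shows "\<bar>f x - f y\<bar> \<le> M * norm (x - y)"
proof -
  have bound: "onorm (\<lambda>h. g x \<bullet> h) \<le> M" if "x \<in> S" for x
  proof (rule onorm_bound)
    show "0 \<le> M" using assms(3)[OF that] norm_ge_zero[of "g x"] by linarith
    show "norm (g x \<bullet> h) \<le> M * norm h" for h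
      using Cauchy_Schwarz_ineq2[of "g x" h] mult_right_mono[OF assms(3)[OF that], of "norm h"] by simp
  qed
  show ?thesis
    using differentiable_bound[where f = f and f' = "\<lambda>x h. g x \<bullet> h" and S = S and B = M and x = x and y = y]
      assms bound by simp
qed


lemma gradient_zero_off_support:
  fixes \<psi> :: "'a::real_inner \<Rightarrow> real"
  assumes "closed K" "\<And>x. x \<notin> K \<Longrightarrow> \<psi> x = 0" "(\<psi> has_derivative (\<lambda>h. p \<bullet> h)) (at x)" "x \<notin> K"
  shows "p = 0"
proof -
  have "((\<lambda>_. 0) has_derivative (\<lambda>h. p \<bullet> h)) (at x)"
    using assms by (intro has_derivative_transform_within_open[OF assms(3), of "- K"]) auto
  from has_derivative_unique[OF this has_derivative_const] have "p \<bullet> p = 0" by metis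
  then show ?thesis by simp
qed

text \<open>Both sides are limits of
  \<open>\<integral> (g (x + ha) - g x) / h \<cdot> (\<psi> x - \<psi> (x - hb)) / h\<close>, and in terms of the correlation
  \<open>R s = \<integral> g (x + s) \<psi> x\<close> this integral is \<open>(R (ha) - R (ha + hb) - R 0 + R (hb)) / h\<^sup>2\<close>,
  which is symmetric in \<open>a\<close> and \<open>b\<close>.\<close>

lemma integral_mixed_partials:
  fixes g \<psi> :: "'a::euclidean_space \<Rightarrow> real"
  assumes T: "compact T" "convex T" and G: "continuous_on T G"
    and g: "\<And>x. x \<in> T \<Longrightarrow> (g has_derivative (\<lambda>h. G x \<bullet> h)) (at x within T)"
    and K: "compact K" "K \<subseteq> interior T" "\<And>x. x \<notin> K \<Longrightarrow> \<psi> x = 0"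
    and \<psi>: "\<And>x. (\<psi> has_derivative (\<lambda>h. P x \<bullet> h)) (at x)" and P: "continuous_on UNIV P"
  shows "integral T (\<lambda>x. (G x \<bullet> a) * (P x \<bullet> b)) = integral T (\<lambda>x. (G x \<bullet> b) * (P x \<bullet> a))"
proof -
  define u where "u x = indicator T x * g x" for x
  have contg: "continuous_on T g"
    using has_derivative_continuous[OF g] by (simp add: continuous_on_eq_continuous_within)
  have cont\<psi>: "continuous_on UNIV \<psi>"
    using has_derivative_continuous[OF \<psi>] by (simp add: continuous_at_imp_continuous_on)
  have [measurable]: "u \<in> borel_measurable borel"
    using borel_measurable_continuous_on_indicator[OF _ contg] T(1)
    by (simp add: u_def[abs_def] compact_imp_closed borel_closed)
  have [measurable]: "\<psi> \<in> borel_measurable borel"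
    using cont\<psi> by (rule borel_measurable_continuous_onI)
  have [measurable]: "T \<in> sets borel" "K \<in> sets borel"
    using T K by (auto simp: compact_imp_closed borel_closed)
  have ind: "integrable lborel (indicator S :: 'a \<Rightarrow> real)" if "compact S" for S
    using that emeasure_bounded_finite[OF compact_imp_bounded[OF that]]
    by (intro integrable_real_indicator) (simp_all add: compact_imp_closed borel_closed)
  obtain B where B: "\<And>x. x \<in> T \<Longrightarrow> \<bar>g x\<bar> \<le> B"
    using compact_imp_bounded[OF compact_continuous_image[OF contg T(1)]]
    by (auto simp: bounded_iff)
  obtain B' where B': "\<And>x. x \<in> K \<Longrightarrow> \<bar>\<psi> x\<bar> \<le> B'"
    using compact_imp_bounded[OF compact_continuous_image[OF continuous_on_subset[OF cont\<psi>] K(1)]]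
    by (auto simp: bounded_iff)
  obtain M where M: "\<And>x. x \<in> T \<Longrightarrow> norm (G x) \<le> M"
    using compact_imp_bounded[OF compact_continuous_image[OF G T(1)]] by (auto simp: bounded_iff)
  obtain N0 where N0: "\<And>x. x \<in> K \<Longrightarrow> norm (P x) \<le> N0"
    using compact_imp_bounded[OF compact_continuous_image[OF continuous_on_subset[OF P] K(1)]]
    by (auto simp: bounded_iff)
  have P0: "P x = 0" if "x \<notin> K" for x
    using gradient_zero_off_support[OF _ K(3) \<psi> that] K(1) by (simp add: compact_imp_closed)
  define N where "N = max N0 0"
  have N: "norm (P x) \<le> N" for x
    using N0[of x] P0[of x] by (cases "x \<in> K") (auto simp: N_def)
  have N_nonneg: "N \<ge> 0" by (simp add: N_def)
  have integrable0: "integrable lborel (\<lambda>x. u (s + x) * \<psi> x)" for s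
  proof (rule Bochner_Integration.integrable_bound)
    show "integrable lborel (\<lambda>x. indicator K x * (max B 0 * max B' 0))"
      using ind[OF K(1)] by (intro Bochner_Integration.integrable_mult_left) simp
    have "\<bar>u (s + x) * \<psi> x\<bar> \<le> \<bar>indicator K x * (max B 0 * max B' 0)\<bar>" for x
    proof (cases "x \<in> K")
      case True
      have "\<bar>u (s + x)\<bar> \<le> max B 0"
        using B[of "s + x"] by (auto simp: u_def indicator_def)
      moreover have "\<bar>\<psi> x\<bar> \<le> max B' 0" using B'[OF True] by simp
      ultimately show ?thesis
        using True by (simp add: abs_mult mult_mono)
    qed (simp add: K(3))
    then show "AE x in lborel. norm (u (s + x) * \<psi> x) \<le> norm (indicator K x * (max B 0 * max B' 0))"
      by simp
  qed simp
  define R where "R s = (LINT x|lborel. u (s + x) * \<psi> x)" for s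
  have corr: "integrable lborel (\<lambda>x. u (s + x) * \<psi> (t + x))"
      "(LINT x|lborel. u (s + x) * \<psi> (t + x)) = R (s - t)" for s t
  proof -
    have "(\<lambda>x. u (s + x) * \<psi> (t + x)) = (\<lambda>x. (\<lambda>y. u ((s - t) + y) * \<psi> y) (t + x))"
      by (auto simp: algebra_simps)
    then show "integrable lborel (\<lambda>x. u (s + x) * \<psi> (t + x))"
      "(LINT x|lborel. u (s + x) * \<psi> (t + x)) = R (s - t)"
      using integrable_lborel_translate[of "\<lambda>y. u ((s - t) + y) * \<psi> y" t]
        integral_lborel_translate[of "\<lambda>y. u ((s - t) + y) * \<psi> y" t] integrable0[of "s - t"]
      by (simp_all add: R_def)
  qed
  define Q where "Q h a b x = (u (h *\<^sub>R a + x) - u x) * (\<psi> x - \<psi> (- (h *\<^sub>R b) + x))" for h a b x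
  have Q_eq: "Q h a b = (\<lambda>x. u (h *\<^sub>R a + x) * \<psi> (0 + x) - u (h *\<^sub>R a + x) * \<psi> (- (h *\<^sub>R b) + x)
      - u (0 + x) * \<psi> (0 + x) + u (0 + x) * \<psi> (- (h *\<^sub>R b) + x))" for h a b
    by (auto simp: Q_def algebra_simps)
  have "integral\<^sup>L lborel (Q h a b) = R (h *\<^sub>R a) - R (h *\<^sub>R a + h *\<^sub>R b) - R 0 + R (h *\<^sub>R b)" for h a b
    unfolding Q_eq
    by (simp only: Bochner_Integration.integral_add Bochner_Integration.integral_diff
        Bochner_Integration.integrable_add Bochner_Integration.integrable_diff corr) simp
  then have Q_sym: "integral\<^sup>L lborel (Q h a b) = integral\<^sup>L lborel (Q h b a)" for h
    by (simp add: add.commute)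
  obtain \<epsilon> where \<epsilon>: "\<epsilon> > 0" "(\<Union>x\<in>K. ball x \<epsilon>) \<subseteq> interior T"
    using compact_subset_open_imp_ball_epsilon_subset[OF K(1) open_interior K(2)] by blast
  have near: "y \<in> T" if "x \<in> K" "dist x y < \<epsilon>" for x y
    using \<epsilon>(2) that interior_subset by fastforce
  \<comment> \<open>Shifts by \<open>h m\<close> along \<open>a\<close> and \<open>b\<close>
    together move a point by less than \<open>\<epsilon>\<close>, so points of \<open>K\<close> stay
    in \<open>T\<close>; the \<open>1\<close> covers \<open>a = b = 0\<close>.\<close>
  define h where "h m = \<epsilon> / (1 + norm a + norm b) / real (Suc m)" for m
  have npos: "0 < 1 + norm a + norm b"
    by (smt (verit) norm_ge_zero)
  have h_pos: "h m > 0" for m using \<epsilon>(1) npos by (simp add: h_def)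
  have h_lim: "h \<longlonglongrightarrow> 0"
    unfolding h_def by (rule LIMSEQ_Suc[OF lim_const_over_n])
  have h_small: "h m * norm a + h m * norm b < \<epsilon>" for m
  proof -
    have "h m * (norm a + norm b) < h m * (1 + norm a + norm b)" using h_pos[of m] by simp
    also have "\<dots> = \<epsilon> / real (Suc m)" using npos by (simp add: h_def)
    also have "\<dots> \<le> \<epsilon>" using \<epsilon>(1) by (simp add: field_simps)
    finally show ?thesis by (simp add: algebra_simps)
  qed
  \<comment> \<open>The smallness condition is symmetric, so the limit is available for both orders
    of \<open>a\<close> and \<open>b\<close> with the same \<open>h\<close>. Lipschitz bounds for
    the two factors absorb the two powers of \<open>h m\<close> and give the dominating
    function.\<close>
  have lim: "(\<lambda>m. LINT x|lborel. Q (h m) a b x / (h m)\<^sup>2)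
      \<longlonglongrightarrow> (LINT x|lborel. indicator T x * ((G x \<bullet> a) * (P x \<bullet> b)))"
    if hs: "\<And>m. h m * norm a + h m * norm b < \<epsilon>" for a b
  proof (rule integral_dominated_convergence)
    have "(\<lambda>x. indicator T x *\<^sub>R ((G x \<bullet> a) * (P x \<bullet> b))) \<in> borel_measurable borel"
      using continuous_on_subset[OF P, of T] G
      by (intro borel_measurable_continuous_on_indicator continuous_intros) auto
    then show "(\<lambda>x. indicator T x * ((G x \<bullet> a) * (P x \<bullet> b))) \<in> borel_measurable lborel"
      by simp
    show "(\<lambda>x. Q (h m) a b x / (h m)\<^sup>2) \<in> borel_measurable lborel" for m
      unfolding Q_def by measurable
    show "integrable lborel (\<lambda>x. indicator T x * ((M * norm a) * (N * norm b)))"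
      using ind[OF T(1)] by (intro Bochner_Integration.integrable_mult_left) simp
    show "AE x in lborel. norm (Q (h m) a b x / (h m)\<^sup>2) \<le> indicator T x * ((M * norm a) * (N * norm b))" for m
    proof (rule AE_I2)
      fix x
      show "norm (Q (h m) a b x / (h m)\<^sup>2) \<le> indicator T x * ((M * norm a) * (N * norm b))"
      proof (cases "x \<in> K \<or> - (h m *\<^sub>R b) + x \<in> K")
        case False
        then have "Q (h m) a b x = 0" using K(3) by (simp add: Q_def)
        moreover have "0 \<le> M" if "x \<in> T" using M[OF that] norm_ge_zero[of "G x"] by linarith
        ultimately show ?thesis using N_nonneg by (auto simp: indicator_def)
      next
        case True
        \<comment> \<open>One of the two points where \<open>\<psi>\<close> is evaluated lies in
          \<open>K\<close>, and both points where \<open>u\<close> is evaluated are within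
          \<open>\<epsilon>\<close> of it. The largest distance,
          \<open>norm (h m *\<^sub>R a + h m *\<^sub>R b)\<close>, is why both norms enter the
          bound.\<close>
        have "x \<in> T \<and> h m *\<^sub>R a + x \<in> T"
        proof -
          have n: "norm (h m *\<^sub>R a) = h m * norm a" "norm (h m *\<^sub>R b) = h m * norm b"
            using h_pos[of m] by simp_all
          have *: "norm (h m *\<^sub>R a + h m *\<^sub>R b) < \<epsilon>" "norm (h m *\<^sub>R a) < \<epsilon>" "norm (h m *\<^sub>R b) < \<epsilon>"
            using hs[of m] norm_triangle_ineq[of "h m *\<^sub>R a" "h m *\<^sub>R b"] n
              mult_nonneg_nonneg[OF less_imp_le[OF h_pos[of m]] norm_ge_zero[of a]]
              mult_nonneg_nonneg[OF less_imp_le[OF h_pos[of m]] norm_ge_zero[of b]]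
            by linarith+
          from True show ?thesis
          proof
            assume "x \<in> K"
            then show ?thesis using near[of x x] near[of x "h m *\<^sub>R a + x"] * \<epsilon>(1)
              by (auto simp: dist_norm)
          next
            assume k: "- (h m *\<^sub>R b) + x \<in> K"
            then show ?thesis using near[OF k, of x] near[OF k, of "h m *\<^sub>R a + x"] *
              by (auto simp: dist_norm norm_minus_commute algebra_simps)
          qed
        qed
        then have xT: "x \<in> T" "h m *\<^sub>R a + x \<in> T" by auto
        have "\<bar>u (h m *\<^sub>R a + x) - u x\<bar> \<le> M * (h m * norm a)"
          using lipschitz_of_gradient_bound[OF T(2) g M xT(2,1)] xT h_pos[of m]
          by (simp add: u_def)
        moreover have "\<bar>\<psi> x - \<psi> (- (h m *\<^sub>R b) + x)\<bar> \<le> N * (h m * norm b)"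
          using lipschitz_of_gradient_bound[OF convex_UNIV \<psi> N, where x = x and y = "- (h m *\<^sub>R b) + x"] h_pos[of m]
          by simp
        ultimately have "\<bar>Q (h m) a b x\<bar> \<le> (M * (h m * norm a)) * (N * (h m * norm b))"
          unfolding Q_def abs_mult by (intro mult_mono order_trans[OF abs_ge_zero]) auto
        also have "\<dots> = (h m)\<^sup>2 * ((M * norm a) * (N * norm b))"
          by (simp add: power2_eq_square)
        finally show ?thesis
          using xT h_pos[of m] by (simp add: abs_mult field_simps)
      qed
    qed
    show "AE x in lborel. (\<lambda>m. Q (h m) a b x / (h m)\<^sup>2) \<longlonglongrightarrow> indicator T x * ((G x \<bullet> a) * (P x \<bullet> b))"
    proof (rule AE_I2)
      fix x
      show "(\<lambda>m. Q (h m) a b x / (h m)\<^sup>2) \<longlonglongrightarrow> indicator T x * ((G x \<bullet> a) * (P x \<bullet> b))"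
      proof (cases "x \<in> interior T")
        case True
        then have x: "x \<in> T" using interior_subset by auto
        have "(g has_derivative (\<lambda>h. G x \<bullet> h)) (at x)"
          using g[OF x] at_within_interior[OF True] by simp
        then have "(u has_derivative (\<lambda>h. G x \<bullet> h)) (at x)"
          by (rule has_derivative_transform_within_open[OF _ open_interior True])
            (use interior_subset in \<open>auto simp: u_def indicator_def\<close>)
        from difference_quotient_tendsto[OF this _ h_lim, of a] h_pos
        have 1: "(\<lambda>m. (u (x + h m *\<^sub>R a) - u x) / h m) \<longlonglongrightarrow> G x \<bullet> a"
          by (metis less_irrefl)
        have ne: "- h m \<noteq> 0" for m using h_pos[of m] by simp
        have 2: "(\<lambda>m. (\<psi> (x + (- h m) *\<^sub>R b) - \<psi> x) / (- h m)) \<longlonglongrightarrow> P x \<bullet> b"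
          using tendsto_minus[OF h_lim] by (intro difference_quotient_tendsto[OF \<psi> ne]) simp
        have "(u (x + h m *\<^sub>R a) - u x) / h m * ((\<psi> (x + (- h m) *\<^sub>R b) - \<psi> x) / (- h m))
            = Q (h m) a b x / (h m)\<^sup>2" for m
          using h_pos[of m] by (simp add: Q_def power2_eq_square field_simps)
        with tendsto_mult[OF 1 2] x show ?thesis
          by simp
      next
        case False
        \<comment> \<open>No derivative of \<open>u\<close> is available at such points, but the
          difference of \<open>\<psi>\<close> is zero for every \<open>m\<close>, and so is the
          limit.\<close>
        have "- (h m *\<^sub>R b) + x \<notin> K" for m
        proof
          assume k: "- (h m *\<^sub>R b) + x \<in> K"
          have "h m * norm b < \<epsilon>"
            using hs[of m] mult_nonneg_nonneg[OF less_imp_le[OF h_pos[of m]] norm_ge_zero[of a]] by linarith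
          then have "norm (h m *\<^sub>R b) < \<epsilon>" using h_pos[of m] by simp
          then have "x \<in> ball (- (h m *\<^sub>R b) + x) \<epsilon>" by (simp add: dist_norm)
          then show False using k \<epsilon>(2) False by blast
        qed
        moreover have "x \<notin> K" using False K(2) by auto
        ultimately show ?thesis by (simp add: Q_def K(3) P0)
      qed
    qed
  qed
  have to_HK: "(LINT x|lborel. indicator T x * ((G x \<bullet> a) * (P x \<bullet> b))) = integral T (\<lambda>x. (G x \<bullet> a) * (P x \<bullet> b))"
    for a b
  proof -
    have "set_integrable lborel T (\<lambda>x. (G x \<bullet> a) * (P x \<bullet> b))"
      unfolding set_integrable_def using continuous_on_subset[OF P, of T] G
      by (intro borel_integrable_compact T continuous_intros) auto
    from set_borel_integral_eq_integral(2)[OF this] show ?thesis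
      by (simp add: set_lebesgue_integral_def)
  qed
  have "(\<lambda>m. LINT x|lborel. Q (h m) a b x / (h m)\<^sup>2) = (\<lambda>m. LINT x|lborel. Q (h m) b a x / (h m)\<^sup>2)"
    using Q_sym by simp
  with lim[of a b] lim[of b a] h_small show ?thesis
    unfolding to_HK[symmetric] by (metis (no_types, lifting) LIMSEQ_unique add.commute)
qed

section \<open>Test fields and the algebra of weak curls\<close>

lemma classical_curl_gradients:
  assumes "\<And>k. ((\<lambda>y. \<phi> y $ k) has_derivative (\<lambda>h. G k \<bullet> h)) (at x)"
  shows "classical_curl \<phi> x
    = vector [G 3 $ 2 - G 2 $ 3, G 1 $ 3 - G 3 $ 1, G 2 $ 1 - G 1 $ 2]"
proof -
  have "(\<phi> has_derivative (\<lambda>h. \<chi> k. G k \<bullet> h)) (at x)"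
    using assms by (subst has_derivative_componentwise_within) (auto simp: Basis_vec_def inner_axis)
  then have "frechet_derivative \<phi> (at x) = (\<lambda>h. \<chi> k. G k \<bullet> h)"
    using frechet_derivative_at[of \<phi> _ x] by simp
  then have "jacobian \<phi> (at x) $ k $ l = G k $ l" for k l
    by (simp add: jacobian_def matrix_def inner_axis)
  then show ?thesis by (simp add: classical_curl_def Let_def)
qed

definition test_grad :: "(real^3 \<Rightarrow> real^3) \<Rightarrow> 3 \<Rightarrow> real^3 \<Rightarrow> real^3" where
  "test_grad \<phi> k x = grad UNIV (\<lambda>y. \<phi> y $ k) x"

lemma
  assumes "test_field S \<phi>"
  shows has_derivative_test_grad: "((\<lambda>y. \<phi> y $ k) has_derivative (\<lambda>h. test_grad \<phi> k x \<bullet> h)) (at x)"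
    and continuous_test_grad: "continuous_on UNIV (test_grad \<phi> k)"
  using C1_on_grad[of UNIV "\<lambda>y. \<phi> y $ k"] assms
  by (auto simp: test_field_def test_grad_def[abs_def])

lemma test_field_classical_curl:
  assumes "test_field S \<phi>"
  shows "classical_curl \<phi> x = vector [test_grad \<phi> 3 x $ 2 - test_grad \<phi> 2 x $ 3,
    test_grad \<phi> 1 x $ 3 - test_grad \<phi> 3 x $ 1, test_grad \<phi> 2 x $ 1 - test_grad \<phi> 1 x $ 2]"
  by (rule classical_curl_gradients) (rule has_derivative_test_grad[OF assms])

lemma continuous_on_components:
  fixes f :: "'a::topological_space \<Rightarrow> ('b::topological_space)^'n"
  assumes "\<And>k. continuous_on S (\<lambda>x. f x $ k)"
  shows "continuous_on S f"
proof -
  have "continuous_on S (\<lambda>x. \<chi> k. f x $ k)" by (intro continuous_on_vec_lambda assms)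
  then show ?thesis by simp
qed

lemma test_field_continuous:
  assumes "test_field S \<phi>"
  shows "continuous_on UNIV \<phi>" "continuous_on UNIV (classical_curl \<phi>)"
proof -
  have "continuous_on UNIV (\<lambda>x. \<phi> x $ k)" for k
    using assms C1_on_continuous by (auto simp: test_field_def)
  then show "continuous_on UNIV \<phi>"
    by (rule continuous_on_components)
  have *: "continuous_on UNIV (\<lambda>x. test_grad \<phi> k x $ l)" for k l
    by (intro continuous_intros continuous_test_grad[OF assms])
  have "continuous_on UNIV (\<lambda>x. classical_curl \<phi> x $ k)" for k
    using exhaust_3[of k] unfolding test_field_classical_curl[OF assms]
    by (elim disjE) (auto intro!: continuous_on_diff *)
  then show "continuous_on UNIV (classical_curl \<phi>)"
    by (rule continuous_on_components)
qed

lemma compact_integrable_inner: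
  fixes u w :: "'a::euclidean_space \<Rightarrow> 'b::euclidean_space"
  assumes "compact S" "continuous_on S u" "continuous_on UNIV w"
  shows "(\<lambda>x. u x \<bullet> w x) integrable_on S"
proof -
  have "continuous_on S (\<lambda>x. u x \<bullet> w x)"
    using assms continuous_on_subset by (intro continuous_intros) blast+
  then have "set_integrable lborel S (\<lambda>x. u x \<bullet> w x)"
    unfolding set_integrable_def by (intro borel_integrable_compact assms)
  then show ?thesis by (rule set_borel_integral_eq_integral(1))
qed

lemma weak_curl_on_scaleR:
  assumes "weak_curl_on S u w"
  shows "weak_curl_on S (c *\<^sub>R u) (c *\<^sub>R w)"
  using assms by (auto simp: weak_curl_on_def scaleR_fun_def)

lemma weak_curl_on_add:
  assumes "compact S" "continuous_on S u" "continuous_on S w" "continuous_on S u'" "continuous_on S w'"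
    "weak_curl_on S u w" "weak_curl_on S u' w'"
  shows "weak_curl_on S (u + u') (w + w')"
  unfolding weak_curl_on_def
proof (intro allI impI)
  fix \<phi> assume \<phi>: "test_field S \<phi>"
  note c = test_field_continuous[OF \<phi>]
  show "integral S (\<lambda>x. (u + u') x \<bullet> classical_curl \<phi> x) = integral S (\<lambda>x. (w + w') x \<bullet> \<phi> x)"
    using assms \<phi> by (simp add: inner_add_left integral_add compact_integrable_inner c weak_curl_on_def)
qed

lemma weak_curl_on_cong:
  assumes "\<And>x. x \<in> S \<Longrightarrow> u x = u' x" "\<And>x. x \<in> S \<Longrightarrow> w x = w' x"
  shows "weak_curl_on S u w \<longleftrightarrow> weak_curl_on S u' w'"
proof -
  have "integral S (\<lambda>x. u x \<bullet> \<phi> x) = integral S (\<lambda>x. u' x \<bullet> \<phi> x)"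
    "integral S (\<lambda>x. w x \<bullet> \<phi> x) = integral S (\<lambda>x. w' x \<bullet> \<phi> x)" for \<phi>
    using assms by (auto intro!: Henstock_Kurzweil_Integration.integral_cong)
  then show ?thesis by (simp add: weak_curl_on_def)
qed

section \<open>Uniqueness of the continuous weak curl\<close>

text \<open>Squaring the positive part makes the truncation at the sphere continuously
  differentiable, which is the regularity that \<open>test_field\<close> demands.\<close>

definition bump :: "real^3 \<Rightarrow> real \<Rightarrow> real^3 \<Rightarrow> real" where
  "bump p r x = (max 0 (r\<^sup>2 - (x - p) \<bullet> (x - p)))\<^sup>2"

lemma has_derivative_max_0_square:
  "((\<lambda>t::real. (max 0 t)\<^sup>2) has_derivative (\<lambda>h. 2 * max 0 t * h)) (at t)"
proof (cases "t = 0")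
  case False
  then consider "t < 0" | "t > 0" by linarith
  then show ?thesis
  proof cases
    case 1
    have "((\<lambda>t::real. 0) has_derivative (\<lambda>h. 0)) (at t)" by simp
    then have "((\<lambda>t::real. (max 0 t)\<^sup>2) has_derivative (\<lambda>h. 0)) (at t)"
      by (rule has_derivative_transform_within_open[where s = "{..<0}"])
        (use 1 in \<open>auto simp: max_def\<close>)
    with 1 show ?thesis by (simp add: max_def)
  next
    case 2
    have "((\<lambda>t::real. t\<^sup>2) has_derivative (\<lambda>h. 2 * t * h)) (at t)"
      by (auto intro!: derivative_eq_intros)
    then have "((\<lambda>t::real. (max 0 t)\<^sup>2) has_derivative (\<lambda>h. 2 * t * h)) (at t)"
      by (rule has_derivative_transform_within_open[where s = "{0<..}"])
        (use 2 in \<open>auto simp: max_def\<close>)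
    with 2 show ?thesis by (simp add: max_def)
  qed
next
  case True
  have "((\<lambda>h::real. (max 0 h)\<^sup>2 / h) \<longlongrightarrow> 0) (at 0)"
  proof (rule tendsto_0_le[where f = "\<lambda>h::real. h" and K = 1])
    show "((\<lambda>h::real. h) \<longlongrightarrow> 0) (at 0)" by (rule tendsto_ident_at)
    show "\<forall>\<^sub>F h::real in at 0. norm ((max 0 h)\<^sup>2 / h) \<le> norm h * 1"
      by (auto simp: max_def power2_eq_square)
  qed
  then have "((\<lambda>t::real. (max 0 t)\<^sup>2) has_real_derivative 0) (at 0)"
    by (simp add: has_field_derivative_iff)
  then show ?thesis using True by (simp add: has_field_derivative_def lambda_zero)
qed

lemma bump_eq_0:
  assumes "r > 0" "x \<notin> cball p r"
  shows "bump p r x = 0"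
proof -
  have "r \<le> norm (x - p)"
    using assms(2) by (simp add: dist_norm norm_minus_commute)
  then have "r\<^sup>2 \<le> (norm (x - p))\<^sup>2"
    using assms(1) power_mono[of r "norm (x - p)" 2] by simp
  then show ?thesis by (simp add: bump_def power2_norm_eq_inner)
qed

lemma test_field_bump:
  assumes "r > 0" "cball p r \<subseteq> interior S"
  shows "test_field S (\<lambda>x. bump p r x *\<^sub>R d)"
proof -
  define G where "G x = (- 4 * max 0 (r\<^sup>2 - (x - p) \<bullet> (x - p))) *\<^sub>R (x - p)" for x
  have "((\<lambda>x. r\<^sup>2 - (x - p) \<bullet> (x - p)) has_derivative (\<lambda>h. - 2 * ((x - p) \<bullet> h))) (at x)" for x
    by (auto intro!: derivative_eq_intros simp: inner_commute)
  from has_derivative_compose[OF this has_derivative_max_0_square]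
  have "(bump p r has_derivative (\<lambda>h. G x \<bullet> h)) (at x)" for x
    by (simp add: bump_def[abs_def] G_def mult_ac)
  then have "((\<lambda>x. bump p r x * d $ k) has_derivative (\<lambda>h. (d $ k *\<^sub>R G x) \<bullet> h)) (at x)" for k x
    by (auto intro!: derivative_eq_intros)
  moreover have "continuous_on UNIV (\<lambda>x. d $ k *\<^sub>R G x)" for k
    unfolding G_def by (intro continuous_intros)
  ultimately have "C1_on UNIV (\<lambda>x. (bump p r x *\<^sub>R d) $ k)" for k
    unfolding C1_on_def by (simp only: vector_scaleR_component real_scaleR_def) blast
  moreover have "bump p r x *\<^sub>R d = 0" if "x \<notin> cball p r" for x
    using bump_eq_0[OF assms(1) that] by simp
  ultimately show ?thesis
    unfolding test_field_def using assms(2) compact_cball[of p r] by metis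
qed

text \<open>The fundamental lemma of the calculus of variations: if the difference \<open>d\<close>
  were nonzero at an interior point \<open>p\<close>, a bump around \<open>p\<close> in the constant
  direction \<open>d p\<close> would have a positive integral against \<open>d\<close>. Continuity
  carries the zero to the boundary, since \<open>T\<close> is the closure of its interior.\<close>

lemma weak_curl_on_unique:
  assumes T: "compact T" "convex T" "interior T \<noteq> {}"
    and w: "continuous_on T w" "weak_curl_on T u w" and w': "continuous_on T w'" "weak_curl_on T u w'"
    and "x \<in> T"
  shows "w x = w' x"
proof -
  define d where "d y = w y - w' y" for y
  have contd: "continuous_on T d" unfolding d_def by (intro continuous_intros w w')
  have int: "integral T (\<lambda>y. d y \<bullet> \<phi> y) = 0" if \<phi>: "test_field T \<phi>" for \<phi>
    using \<phi> w w' test_field_continuous[OF \<phi>]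
    by (simp add: d_def inner_diff_left integral_diff compact_integrable_inner T weak_curl_on_def)
  have zero: "d p = 0" if p: "p \<in> interior T" for p
  proof (rule ccontr)
    assume "d p \<noteq> 0"
    then have pos: "d p \<bullet> d p > 0" by simp
    have "isCont d p"
      using contd p by (simp add: continuous_on_interior)
    then have "isCont (\<lambda>y. d y \<bullet> d p) p" by (intro continuous_intros)
    then have "\<forall>\<^sub>F y in nhds p. d y \<bullet> d p > 0"
      using pos order_tendstoD(1)[of "\<lambda>y. d y \<bullet> d p" "d p \<bullet> d p" "nhds p" 0]
        tendsto_at_iff_tendsto_nhds[of "\<lambda>y. d y \<bullet> d p" p]
      by (simp add: isCont_def)
    then obtain e where e: "e > 0" "\<And>y. dist y p < e \<Longrightarrow> d y \<bullet> d p > 0"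
      by (auto simp: eventually_nhds_metric)
    obtain r0 where r0: "r0 > 0" "cball p r0 \<subseteq> interior T"
      using p open_contains_cball[of "interior T"] by auto
    define r where "r = min r0 (e / 2)"
    have r: "r > 0" "cball p r \<subseteq> interior T" "r < e"
      using r0 e(1) by (auto simp: r_def)
    define F where "F y = d y \<bullet> (bump p r y *\<^sub>R d p)" for y
    have F_nonneg: "F y \<ge> 0" for y
      using bump_eq_0[OF r(1), of y p] e(2)[of y] r(3)
      by (cases "y \<in> cball p r") (auto simp: F_def bump_def dist_commute less_imp_le)
    have contF: "continuous_on T F"
      unfolding F_def bump_def by (intro continuous_intros contd)
    obtain a b where ab: "p \<in> box a b" "cbox a b \<subseteq> interior T"
      using open_contains_cbox[OF open_interior p] by metis
    then have abT: "cbox a b \<subseteq> T" using interior_subset by blast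
    have "set_integrable lborel T F" "set_integrable lborel (cbox a b) F"
      unfolding set_integrable_def
      by (intro borel_integrable_compact T(1) compact_cbox contF continuous_on_subset[OF contF abT])+
    then have ints: "F integrable_on T" "F integrable_on cbox a b"
      by (auto intro: set_borel_integral_eq_integral(1))
    have zeroT: "integral T F = 0"
      using int[OF test_field_bump[OF r(1,2)]] by (simp add: F_def[abs_def])
    have "integral (cbox a b) F \<le> integral T F"
      using F_nonneg by (intro integral_subset_le abT ints) auto
    moreover have "0 \<le> integral (cbox a b) F"
      using F_nonneg by (intro integral_nonneg ints) auto
    ultimately have "integral (cbox a b) F = 0" using zeroT by linarith
    moreover have "box a b \<noteq> {}" using ab(1) by auto
    ultimately have "\<forall>x\<in>cbox a b. F x = 0"
      using integral_cbox_eq_0_iff[OF continuous_on_subset[OF contF abT]] F_nonneg by simp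
    then have "F p = 0" using ab(1) box_subset_cbox by auto
    then show False using pos r(1) by (simp add: F_def bump_def)
  qed
  have "closure (interior T) = T"
    using convex_closure_interior[OF T(2,3)] T(1) by (simp add: compact_imp_closed)
  then have "d x = 0"
    using continuous_constant_on_closure[of "interior T" d 0 x] contd zero \<open>x \<in> T\<close> by simp
  then show ?thesis by (simp add: d_def)
qed

lemma curl_eqI:
  assumes T: "compact T" "convex T" "interior T \<noteq> {}"
    and w: "continuous_on T w" "\<And>x. x \<notin> T \<Longrightarrow> w x = 0" "weak_curl_on T u w"
  shows "curl T u = w"
  unfolding curl_def
proof (rule the_equality)
  show "continuous_on T w \<and> (\<forall>x. x \<notin> T \<longrightarrow> w x = 0) \<and> weak_curl_on T u w" using w by blast
  fix w' assume w': "continuous_on T w' \<and> (\<forall>x. x \<notin> T \<longrightarrow> w' x = 0) \<and> weak_curl_on T u w'"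
  show "w' = w"
  proof
    fix x show "w' x = w x"
      using weak_curl_on_unique[OF T _ _ w(1,3), of w' x] w' w(2) by (cases "x \<in> T") auto
  qed
qed

section \<open>The weak curl of a scaled gradient and of a Whitney form\<close>

lemma sum_fun_apply: "(\<Sum>i\<in>A. f i) x = (\<Sum>i\<in>A. f i x)"
  by (induction A rule: infinite_finite_induct) auto

lemma scaleR_fun_apply [simp]: "(c *\<^sub>R f) x = c *\<^sub>R f x"
  by (simp add: scaleR_fun_def)

text \<open>By the product rule and the antisymmetry of the triple product, the integrand is
  \<open>grad T g\<close> paired with the curl of the product of \<open>u\<close> and
  \<open>\<phi>\<close>. This integrates to zero because a gradient has no weak curl, which for a C1
  function is \<open>integral_mixed_partials\<close>.\<close>

lemma integral_scaled_gradient_curl: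
  assumes T: "compact T" "convex T" "interior T \<noteq> {}" and u: "C1_on T u" and g: "C1_on T g"
    and \<phi>: "test_field T \<phi>"
  shows "((\<lambda>x. u x * (grad T g x \<bullet> classical_curl \<phi> x)
      - cross3 (grad T u x) (grad T g x) \<bullet> \<phi> x) has_integral 0) T"
proof -
  obtain K where K: "compact K" "K \<subseteq> interior T" "\<And>x. x \<notin> K \<Longrightarrow> \<phi> x = 0"
    using \<phi> by (auto simp: test_field_def)
  define G where "G = grad T g"
  define U where "U = grad T u"
  note G = has_derivative_grad[OF T(2,3) g, folded G_def] continuous_on_grad[OF T(2,3) g, folded G_def]
  note U = has_derivative_grad[OF T(2,3) u, folded U_def] continuous_on_grad[OF T(2,3) u, folded U_def]
  note D = has_derivative_test_grad[OF \<phi>] continuous_test_grad[OF \<phi>]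
  have D0: "test_grad \<phi> k x = 0" if "x \<notin> K" for k x
    by (rule gradient_zero_off_support[OF _ _ D(1) that]) (use K in \<open>auto simp: compact_imp_closed\<close>)
  \<comment> \<open>The gradient of \<open>u\<close> times a component of \<open>\<phi>\<close>. Off
    \<open>T\<close> the values of \<open>u\<close> and \<open>U\<close> are arbitrary, but
    \<open>\<phi>\<close> and its gradients vanish off \<open>K\<close>, so the product is C1 on the
    whole space.\<close>
  define P where "P k x = u x *\<^sub>R test_grad \<phi> k x + \<phi> x $ k *\<^sub>R U x" for k x
  have P0: "P k x = 0" if "x \<notin> K" for k x
    using D0[OF that] K(3)[OF that] by (simp add: P_def)
  have openK: "open (- K)" using K(1) by (simp add: compact_imp_closed open_Compl)
  have UNIV_eq: "UNIV = interior T \<union> - K" using K(2) by auto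
  have P_cont: "continuous_on UNIV (P k)" for k
  proof -
    have "continuous_on (interior T) \<phi>" "continuous_on (interior T) (test_grad \<phi> k)"
      "continuous_on (interior T) u" "continuous_on (interior T) U"
      using test_field_continuous(1)[OF \<phi>] D(2) C1_on_continuous[OF u] U(2) interior_subset
      by (auto intro!: continuous_on_component intro: continuous_on_subset)
    then have "continuous_on (interior T) (P k)"
      unfolding P_def by (intro continuous_intros)
    moreover have "continuous_on (- K) (P k)"
      using P0 by (subst continuous_on_cong[OF refl, of _ _ "\<lambda>_. 0"]) auto
    ultimately show ?thesis
      unfolding UNIV_eq by (intro continuous_on_open_Un openK) auto
  qed
  have P_deriv: "((\<lambda>x. u x * \<phi> x $ k) has_derivative (\<lambda>h. P k x \<bullet> h)) (at x)" for k x
  proof (cases "x \<in> K")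
    case True
    then have "x \<in> interior T" using K(2) by auto
    then have "(u has_derivative (\<lambda>h. U x \<bullet> h)) (at x)"
      using U(1)[of x] at_within_interior[of x T] interior_subset by auto
    from has_derivative_mult[OF this D(1)[of k x]] show ?thesis
      by (simp add: P_def inner_add_left mult.commute)
  next
    case False
    have "((\<lambda>x. u x * \<phi> x $ k) has_derivative (\<lambda>h. 0)) (at x)"
      by (rule has_derivative_transform_within_open[OF has_derivative_const openK, of x 0])
        (use False K(3) in auto)
    then show ?thesis by (simp add: P0[OF False])
  qed
  have int: "((\<lambda>x. G x $ a * P k x $ b - G x $ b * P k x $ a) has_integral 0) T" for a b k
  proof -
    have "(\<lambda>x. G x $ a * P k x $ b) integrable_on T" for a b
      using compact_integrable_inner[OF T(1), of "\<lambda>x. G x $ a" "\<lambda>x. P k x $ b"] G(2) P_cont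
      by (auto intro!: continuous_on_component)
    then have "((\<lambda>x. G x $ a * P k x $ b - G x $ b * P k x $ a) has_integral
        (integral T (\<lambda>x. G x $ a * P k x $ b) - integral T (\<lambda>x. G x $ b * P k x $ a))) T"
      by (intro has_integral_diff integrable_integral)
    moreover have "integral T (\<lambda>x. (G x \<bullet> axis a 1) * (P k x \<bullet> axis b 1))
        = integral T (\<lambda>x. (G x \<bullet> axis b 1) * (P k x \<bullet> axis a 1))"
      using K by (intro integral_mixed_partials[OF T(1,2) G(2,1) K(1,2) _ P_deriv P_cont]) auto
    ultimately show ?thesis by (simp add: inner_axis)
  qed
  \<comment> \<open>Grouped by the components of the field, each pair integrates to zero by
    symmetry; regrouped by the components of \<open>G\<close>, the sum is \<open>G\<close> paired
    with the curl of the product.\<close>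
  have "((\<lambda>x. (G x $ 1 * P 3 x $ 2 - G x $ 2 * P 3 x $ 1) + (G x $ 3 * P 2 x $ 1 - G x $ 1 * P 2 x $ 3)
      + (G x $ 2 * P 1 x $ 3 - G x $ 3 * P 1 x $ 2)) has_integral (0 + 0 + 0)) T"
    by (intro has_integral_add int)
  moreover have "(G x $ 1 * P 3 x $ 2 - G x $ 2 * P 3 x $ 1) + (G x $ 3 * P 2 x $ 1 - G x $ 1 * P 2 x $ 3)
      + (G x $ 2 * P 1 x $ 3 - G x $ 3 * P 1 x $ 2)
    = u x * (G x \<bullet> classical_curl \<phi> x) - cross3 (U x) (G x) \<bullet> \<phi> x" for x
    by (simp add: P_def test_field_classical_curl[OF \<phi>] cross3_def inner_vec_def sum_3 algebra_simps)
  ultimately show ?thesis by (simp add: G_def U_def)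
qed

text \<open>Exchanging the two functions reverses the cross product, and the second product enters
  with a minus sign, whence the factor \<open>2\<close>.\<close>

lemma weak_curl_on_whitney:
  assumes T: "compact T" "convex T" "interior T \<noteq> {}" and "C1_on T (lam i)" "C1_on T (lam j)"
  shows "weak_curl_on T (whitney T lam i j) (\<lambda>x. 2 *\<^sub>R cross3 (grad T (lam i) x) (grad T (lam j) x))"
  unfolding weak_curl_on_def
proof (intro allI impI)
  fix \<phi> assume \<phi>: "test_field T \<phi>"
  let ?c = "\<lambda>x. cross3 (grad T (lam i) x) (grad T (lam j) x)"
  have "((\<lambda>x. whitney T lam i j x \<bullet> classical_curl \<phi> x - (2 *\<^sub>R ?c x) \<bullet> \<phi> x) has_integral (0 - 0)) T"
    using has_integral_diff[OF integral_scaled_gradient_curl[OF T assms(4,5) \<phi>]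
        integral_scaled_gradient_curl[OF T assms(5,4) \<phi>]]
      cross_skew[of "grad T (lam j) x" "grad T (lam i) x" for x]
    by (simp add: whitney_def algebra_simps)
  moreover have "(\<lambda>x. (2 *\<^sub>R ?c x) \<bullet> \<phi> x) integrable_on T"
    using continuous_on_grad[OF T(2,3)] assms test_field_continuous[OF \<phi>]
    by (intro compact_integrable_inner continuous_intros continuous_on_cross) auto
  ultimately have "((\<lambda>x. (whitney T lam i j x \<bullet> classical_curl \<phi> x - (2 *\<^sub>R ?c x) \<bullet> \<phi> x)
      + (2 *\<^sub>R ?c x) \<bullet> \<phi> x) has_integral (0 - 0 + integral T (\<lambda>x. (2 *\<^sub>R ?c x) \<bullet> \<phi> x))) T"
    by (intro has_integral_add integrable_integral)
  then show "integral T (\<lambda>x. whitney T lam i j x \<bullet> classical_curl \<phi> x)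
      = integral T (\<lambda>x. (2 *\<^sub>R ?c x) \<bullet> \<phi> x)"
    by (simp add: integral_unique)
qed

text \<open>\<open>has_curl T u w\<close> says that \<open>w\<close> is the continuous representative of the curl of \<open>u\<close> picked
  by \<^const>\<open>curl\<close>; unlike an equation for \<^const>\<open>curl\<close>, it is closed under linear combinations.\<close>

definition has_curl :: "(real^3) set \<Rightarrow> (real^3 \<Rightarrow> real^3) \<Rightarrow> (real^3 \<Rightarrow> real^3) \<Rightarrow> bool" where
  "has_curl T u w \<longleftrightarrow> continuous_on T u \<and> continuous_on T w \<and> (\<forall>x. x \<notin> T \<longrightarrow> w x = 0) \<and> weak_curl_on T u w"

lemma has_curl_imp_curl:
  assumes "compact T" "convex T" "interior T \<noteq> {}" "has_curl T u w"
  shows "curl T u = w"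
  using curl_eqI assms by (auto simp: has_curl_def)

lemma has_curl_scaleR:
  assumes "has_curl T u w"
  shows "has_curl T (c *\<^sub>R u) (c *\<^sub>R w)"
  using assms weak_curl_on_scaleR by (auto simp: has_curl_def scaleR_fun_def intro: continuous_intros)

lemma has_curl_add:
  assumes "compact T" "has_curl T u w" "has_curl T u' w'"
  shows "has_curl T (u + u') (w + w')"
  using assms weak_curl_on_add by (auto simp: has_curl_def plus_fun_def intro: continuous_intros)

lemma has_curl_diff:
  assumes "compact T" "has_curl T u w" "has_curl T u' w'"
  shows "has_curl T (u - u') (w - w')"
  using has_curl_add[OF assms(1,2) has_curl_scaleR[OF assms(3), of "-1"]] by simp

lemma has_curl_sum:
  assumes "compact T" "\<And>i. i \<in> A \<Longrightarrow> has_curl T (u i) (w i)"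
  shows "has_curl T (\<Sum>i\<in>A. u i) (\<Sum>i\<in>A. w i)"
  using assms(2)
proof (induction A rule: infinite_finite_induct)
  case (insert a A)
  have "has_curl T (u a + sum u A) (w a + sum w A)"
    by (intro has_curl_add[OF assms(1)] insert) auto
  then show ?case by (simp only: sum.insert[OF insert(1,2)])
qed (auto simp: has_curl_def weak_curl_on_def zero_fun_def)

lemma has_curl_whitney:
  assumes T: "compact T" "convex T" "interior T \<noteq> {}" and "C1_on T (lam i)" "C1_on T (lam j)"
  shows "has_curl T (whitney T lam i j)
    (\<lambda>x. if x \<in> T then 2 *\<^sub>R cross3 (grad T (lam i) x) (grad T (lam j) x) else 0)"
proof -
  note c = continuous_on_grad[OF T(2,3) assms(4)] continuous_on_grad[OF T(2,3) assms(5)]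
    C1_on_continuous[OF assms(4)] C1_on_continuous[OF assms(5)]
  have "continuous_on T (\<lambda>x. if x \<in> T then 2 *\<^sub>R cross3 (grad T (lam i) x) (grad T (lam j) x) else 0)"
    using c by (subst continuous_on_cong[OF refl,
        of _ _ "\<lambda>x. 2 *\<^sub>R cross3 (grad T (lam i) x) (grad T (lam j) x)"])
      (auto intro!: continuous_intros continuous_on_cross)
  moreover have "continuous_on T (whitney T lam i j)"
    using c unfolding whitney_def[abs_def] by (intro continuous_intros)
  moreover have "weak_curl_on T (whitney T lam i j)
      (\<lambda>x. if x \<in> T then 2 *\<^sub>R cross3 (grad T (lam i) x) (grad T (lam j) x) else 0)"
    using weak_curl_on_whitney[OF assms]
    by (subst weak_curl_on_cong[of _ _ "whitney T lam i j"
          _ "\<lambda>x. 2 *\<^sub>R cross3 (grad T (lam i) x) (grad T (lam j) x)"]) auto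
  ultimately show ?thesis unfolding has_curl_def by simp
qed

section \<open>Faces and edges of a polytope in space\<close>

text \<open>The part \<open>r\<close> of \<open>w\<close> orthogonal to \<open>a\<close> can be
  added to a point of the hyperplane without leaving it, so \<open>w \<bullet> r = 0\<close>; being
  orthogonal to \<open>a\<close> as well, \<open>r\<close> is orthogonal to itself.\<close>

lemma parallel_if_hyperplane_subset:
  fixes a w :: "'a::real_inner"
  assumes "a \<noteq> 0" and sub: "\<And>z. a \<bullet> z = b \<Longrightarrow> w \<bullet> z = c"
  shows "\<exists>k. w = k *\<^sub>R a"
proof -
  define x0 where "x0 = (b / (a \<bullet> a)) *\<^sub>R a"
  define k where "k = (w \<bullet> a) / (a \<bullet> a)"
  define r where "r = w - k *\<^sub>R a"
  have x0: "a \<bullet> x0 = b" using assms(1) by (simp add: x0_def)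
  have r: "a \<bullet> r = 0" using assms(1) by (simp add: r_def k_def inner_diff_right inner_commute)
  have "w \<bullet> r = w \<bullet> (x0 + r) - w \<bullet> x0" by (simp add: inner_add_right)
  also have "\<dots> = 0" using sub[of x0] sub[of "x0 + r"] x0 r by (simp add: inner_add_right)
  finally have "w \<bullet> r = 0" .
  with r have "r \<bullet> r = 0" by (simp add: r_def inner_diff_left inner_diff_right inner_commute)
  then show ?thesis by (auto simp: r_def)
qed

lemma parallel_to_unit_normal:
  fixes n w :: "real^3"
  assumes "norm n = 1" "cross3 n w = 0"
  shows "w = (w \<bullet> n) *\<^sub>R n"
proof -
  have "cross3 n (cross3 n w) = (n \<bullet> w) *\<^sub>R n - (n \<bullet> n) *\<^sub>R w" by (rule Lagrange)
  with assms show ?thesis by (simp add: dot_square_norm inner_commute)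
qed

lemma cross3_of_tangents:
  fixes n u w :: "real^3"
  assumes "norm n = 1" "n \<bullet> u = 0" "n \<bullet> w = 0"
  shows "cross3 u w = (cross3 u w \<bullet> n) *\<^sub>R n"
  using assms by (intro parallel_to_unit_normal) (simp_all add: Lagrange)

section \<open>Facets, outward normals and areas\<close>

locale solid_polytope =
  fixes T :: "(real^3) set"
  assumes polytope: "polytope T" and interior: "interior T \<noteq> {}"
begin

lemma compact: "compact T" and convex: "convex T" and polyhedron: "polyhedron T"
  using polytope polytope_imp_compact polytope_imp_convex polytope_imp_polyhedron by auto

lemma aff_dim_body: "aff_dim T = 3"
proof -
  have "aff_dim (interior T) \<le> aff_dim T" by (intro aff_dim_subset interior_subset)
  moreover have "aff_dim (interior T) = 3" using aff_dim_open[OF open_interior interior] by simp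
  moreover have "aff_dim T \<le> 3" using aff_dim_le_DIM[of T] by simp
  ultimately show ?thesis by simp
qed

lemma finite_faces: "finite (faces T)"
  using finite_polytope_facets[OF polytope] by (simp add: faces_def)

lemma face_subset: "f \<in> faces T \<Longrightarrow> f \<subseteq> T"
  by (auto simp: faces_def dest: facet_of_imp_subset)

lemma face_face_of: "f \<in> faces T \<Longrightarrow> f face_of T"
  by (simp add: faces_def facet_of_imp_face_of)

lemma aff_dim_face: "f \<in> faces T \<Longrightarrow> aff_dim f = 2"
  by (simp add: faces_def facet_of_def aff_dim_body)

lemma face_nonempty: "f \<in> faces T \<Longrightarrow> f \<noteq> {}"
  by (simp add: faces_def facet_of_def)

lemma convex_face: "f \<in> faces T \<Longrightarrow> convex f"
  using face_face_of face_of_imp_convex by blast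

lemma compact_face: "f \<in> faces T \<Longrightarrow> compact f"
  using face_face_of face_of_imp_compact compact convex by blast

lemma Union_faces: "\<Union>(faces T) = frontier T"
  using rel_frontier_of_polyhedron[OF polyhedron] rel_frontier_nonempty_interior[OF interior]
  by (simp add: faces_def)

lemma faces_nonempty: "faces T \<noteq> {}"
  using polytope_facet_exists[OF polytope] aff_dim_body by (auto simp: faces_def)

text \<open>\<open>normal\<close> is a definite description. A facet has dimension two, so its
  affine hull is the whole supporting plane and any admissible vector is parallel to
  \<open>a\<close>; a point of \<open>T\<close> off that plane fixes the sign, and the norm fixes
  the length.\<close>

lemma normal_properties:
  assumes f: "f \<in> faces T"
  obtains b where "norm (normal T f) = 1" "\<And>y. y \<in> T \<Longrightarrow> normal T f \<bullet> y \<le> b"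
    "\<And>x. x \<in> f \<longleftrightarrow> x \<in> T \<and> normal T f \<bullet> x = b" "affine hull f = {x. normal T f \<bullet> x = b}"
proof -
  obtain a b where ab: "a \<noteq> 0" "T \<subseteq> {x. a \<bullet> x \<le> b}" "f = T \<inter> {x. a \<bullet> x = b}"
    using facet_of_polyhedron[OF polyhedron] f by (auto simp: faces_def)
  have hull: "affine hull f = {x. a \<bullet> x = b}"
  proof -
    have "affine hull f = affine hull {x. a \<bullet> x = b}"
      using aff_dim_eq_full_gen[of f "{x. a \<bullet> x = b}"] ab aff_dim_face[OF f] by simp
    then show ?thesis by (simp add: affine_hyperplane affine_hull_eq)
  qed
  obtain y0 where y0: "y0 \<in> T" "a \<bullet> y0 < b"
  proof (rule ccontr)
    assume "\<not> thesis"
    then have "a \<bullet> y = b" if "y \<in> T" for y using that ab(2) \<open>\<And>y0. _ \<Longrightarrow> _ \<Longrightarrow> thesis\<close> by force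
    then have "a = 0" by (rule orthogonal_to_body[OF interior])
    with ab(1) show False by simp
  qed
  define m where "m = a /\<^sub>R norm a"
  have m: "norm m = 1" using ab(1) by (simp add: m_def)
  have mb: "m \<bullet> x = (a \<bullet> x) / norm a" for x by (simp add: m_def divide_inverse mult.commute)
  have "normal T f = m"
    unfolding normal_def
  proof (rule the_equality)
    show "norm m = 1 \<and> (\<forall>x\<in>f. \<forall>y\<in>T. m \<bullet> y \<le> m \<bullet> x)"
      using m ab by (auto simp: mb divide_right_mono)
    fix m' assume m': "norm m' = 1 \<and> (\<forall>x\<in>f. \<forall>y\<in>T. m' \<bullet> y \<le> m' \<bullet> x)"
    obtain x0 where x0: "x0 \<in> f" using face_nonempty[OF f] by auto
    have "f \<subseteq> {z. m' \<bullet> z = m' \<bullet> x0}"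
      using m' x0 face_subset[OF f] by (auto intro!: order_antisym)
    then have "affine hull f \<subseteq> {z. m' \<bullet> z = m' \<bullet> x0}"
      by (intro hull_minimal affine_hyperplane)
    then obtain k where k: "m' = k *\<^sub>R a"
      using parallel_if_hyperplane_subset[OF ab(1), of b m' "m' \<bullet> x0"] hull by auto
    have "m' \<bullet> y0 \<le> m' \<bullet> x0" "a \<bullet> x0 = b" using m' x0 y0(1) ab(3) by auto
    then have "k * (b - a \<bullet> y0) \<ge> 0" by (simp add: k algebra_simps)
    then have "k \<ge> 0" using y0(2) by (simp add: zero_le_mult_iff)
    moreover have "\<bar>k\<bar> * norm a = 1" using m' by (simp add: k)
    ultimately have "k = inverse (norm a)" using ab(1) by (simp add: field_simps)
    then show "m' = m" by (simp add: k m_def)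
  qed
  moreover have "a \<bullet> x = b \<longleftrightarrow> m \<bullet> x = b / norm a" "a \<bullet> x \<le> b \<longleftrightarrow> m \<bullet> x \<le> b / norm a" for x
    using ab(1) by (simp_all add: mb divide_right_mono divide_le_cancel)
  ultimately show thesis
    using m ab(2,3) hull by (intro that[of "b / norm a"]) auto
qed

lemma norm_normal: "f \<in> faces T \<Longrightarrow> norm (normal T f) = 1"
  by (metis normal_properties)

lemma normal_le: "f \<in> faces T \<Longrightarrow> x \<in> f \<Longrightarrow> y \<in> T \<Longrightarrow> normal T f \<bullet> y \<le> normal T f \<bullet> x"
  by (erule normal_properties) auto

lemma normal_eq_iff: "f \<in> faces T \<Longrightarrow> x \<in> f \<Longrightarrow> y \<in> T \<Longrightarrow> normal T f \<bullet> y = normal T f \<bullet> x \<longleftrightarrow> y \<in> f"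
  by (erule normal_properties) auto

lemma normal_const: "f \<in> faces T \<Longrightarrow> x \<in> f \<Longrightarrow> y \<in> f \<Longrightarrow> normal T f \<bullet> y = normal T f \<bullet> x"
  using normal_eq_iff face_subset by blast

lemma normal_orthogonal: "f \<in> faces T \<Longrightarrow> x \<in> f \<Longrightarrow> y \<in> f \<Longrightarrow> normal T f \<bullet> (y - x) = 0"
  using normal_const[of f x y] by (simp add: inner_diff_right)

lemma parallel_normal:
  assumes f: "f \<in> faces T" and x: "x \<in> f" and w: "\<And>y. y \<in> f \<Longrightarrow> w \<bullet> y = w \<bullet> x"
  shows "\<exists>k. w = k *\<^sub>R normal T f"
proof -
  obtain b where b: "norm (normal T f) = 1" "affine hull f = {x. normal T f \<bullet> x = b}"
    using normal_properties[OF f] by metis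
  have "f \<subseteq> {z. w \<bullet> z = w \<bullet> x}" using w by auto
  then have "affine hull f \<subseteq> {z. w \<bullet> z = w \<bullet> x}"
    by (intro hull_minimal affine_hyperplane)
  with b show ?thesis
    by (intro parallel_if_hyperplane_subset[of _ b _ "w \<bullet> x"]) auto
qed

lemma normal_less_interior:
  assumes f: "f \<in> faces T" "x \<in> f" and z: "z \<in> interior T"
  shows "normal T f \<bullet> z < normal T f \<bullet> x"
proof (rule ccontr)
  assume "\<not> ?thesis"
  moreover have "z \<in> T" using z interior_subset by auto
  ultimately have "z \<in> f" using normal_le[OF f] normal_eq_iff[OF f] by force
  moreover have "f \<subseteq> frontier T" using f Union_faces by auto
  ultimately show False using z by (auto simp: frontier_def)
qed

text \<open>Otherwise the prism would lie in a plane with some normal \<open>a\<close>: constancy on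
  \<open>f\<close> makes \<open>a\<close> a multiple of the face normal, and constancy along the
  height makes it orthogonal to that normal.\<close>

lemma area_pos:
  assumes f: "f \<in> faces T"
  shows "area T f > 0"
proof -
  let ?n = "normal T f"
  let ?P = "{x + t *\<^sub>R ?n | x t. x \<in> f \<and> 0 \<le> t \<and> t \<le> 1}"
  have P: "?P = (\<lambda>(x, t). x + t *\<^sub>R ?n) ` (f \<times> {0..1})" by force
  have "convex ?P"
    unfolding P
  proof (rule convex_linear_image)
    show "linear (\<lambda>(x, t). x + t *\<^sub>R ?n)"
      by (rule linearI) (auto simp: algebra_simps)
    show "convex (f \<times> {0..1::real})" by (intro convex_Times convex_face f) auto
  qed
  moreover have "bounded ?P"
    unfolding P
    by (intro compact_imp_bounded compact_continuous_image compact_Times compact_face f)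
      (auto simp: case_prod_unfold intro!: continuous_intros)
  ultimately have "?P \<in> lmeasurable" by (rule measurable_convex)
  moreover have "interior ?P \<noteq> {}"
  proof
    assume "interior ?P = {}"
    then obtain a b where ab: "a \<noteq> 0" "?P \<subseteq> {x. a \<bullet> x = b}"
      using empty_interior_subset_hyperplane[OF \<open>convex ?P\<close>] by blast
    have *: "a \<bullet> (x + t *\<^sub>R ?n) = b" if "x \<in> f" "0 \<le> t" "t \<le> 1" for x t
      using ab(2) that by blast
    obtain x where x: "x \<in> f" using face_nonempty[OF f] by auto
    have "a \<bullet> y = a \<bullet> x" if "y \<in> f" for y using *[OF that, of 0] *[OF x, of 0] by simp
    then obtain k where k: "a = k *\<^sub>R ?n" using parallel_normal[OF f x] by blast
    have "a \<bullet> ?n = 0" using *[OF x, of 0] *[OF x, of 1] by (simp add: inner_add_right)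
    then have "k = 0" using norm_normal[OF f] by (simp add: k dot_square_norm)
    with k ab(1) show False by simp
  qed
  ultimately have "measure lebesgue ?P \<noteq> 0"
    using negligible_convex_interior[OF \<open>convex ?P\<close>] negligible_iff_measure0 by blast
  then show ?thesis by (simp add: area_def less_le)
qed

section \<open>Intersections of faces, edges and their sides\<close>

lemma face_eqI_subset:
  assumes "f \<in> faces T" "g \<in> faces T" "f \<subseteq> g"
  shows "f = g"
proof (rule ccontr)
  assume "f \<noteq> g"
  moreover have "f face_of g"
    using face_of_subset[OF face_face_of[OF assms(1)] assms(3) face_subset[OF assms(2)]] .
  ultimately have "aff_dim f < aff_dim g" using face_of_aff_dim_lt convex_face assms(2) by blast
  then show False using aff_dim_face assms by simp
qed

lemma aff_dim_Int_faces:
  assumes "f \<in> faces T" "g \<in> faces T" "f \<noteq> g"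
  shows "aff_dim (f \<inter> g) \<le> 1" "(f \<inter> g) face_of T"
proof -
  show 1: "(f \<inter> g) face_of T" using face_of_Int face_face_of assms by blast
  then have "(f \<inter> g) face_of f" using face_of_subset face_subset assms by blast
  moreover have "f \<inter> g \<noteq> f" using face_eqI_subset assms by blast
  ultimately have "aff_dim (f \<inter> g) < aff_dim f" using face_of_aff_dim_lt convex_face assms(1) by blast
  then show "aff_dim (f \<inter> g) \<le> 1" using aff_dim_face[OF assms(1)] by simp
qed

text \<open>A compact convex set of dimension at most one is a segment, and two distinct extreme
  points of it are its ends. This recognises a set cut out of the polytope as an edge once it
  contains two vertices.\<close>

lemma face_eq_segment:
  assumes H: "H face_of T" "aff_dim H \<le> 1"
    and p: "p extreme_point_of T" "p \<in> H" and q: "q extreme_point_of T" "q \<in> H" and "p \<noteq> q"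
  shows "H = closed_segment p q" "H edge_of T"
proof -
  obtain a b where ab: "H = closed_segment a b"
    using compact_convex_collinear_segment[of H] H p(2) face_of_imp_compact[OF convex compact H(1)]
      face_of_imp_convex collinear_aff_dim by (metis empty_iff)
  have "p extreme_point_of H" "q extreme_point_of H"
    using extreme_point_of_face[OF H(1)] p q by auto
  then have "{p, q} = {a, b}" using \<open>p \<noteq> q\<close> by (auto simp: ab extreme_point_of_segment)
  then show eq: "H = closed_segment p q"
    using ab closed_segment_commute by (auto simp: doubleton_eq_iff)
  show "H edge_of T"
    using H(1) \<open>p \<noteq> q\<close> by (simp add: edge_of_def eq segment_convex_hull aff_dim_convex_hull)
qed

lemma edge_ends:
  assumes "e edge_of T"
  obtains p q where "p extreme_point_of T" "q extreme_point_of T" "p \<noteq> q" "e = closed_segment p q"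
proof -
  have e: "e face_of T" "aff_dim e = 1" using assms by (auto simp: edge_of_def)
  then have "e \<noteq> {}" by auto
  then obtain a b where ab: "e = closed_segment a b"
    using compact_convex_collinear_segment[of e] face_of_imp_compact[OF convex compact e(1)]
      face_of_imp_convex[OF e(1)] collinear_aff_dim[of e] e(2) by auto
  moreover have "a \<noteq> b" using e(2) ab by auto
  moreover have "a extreme_point_of T" "b extreme_point_of T"
    using extreme_point_of_face[OF e(1)] extreme_point_of_segment[of _ a b] ab by auto
  ultimately show thesis using that by blast
qed

lemma edge_of_face_iff:
  assumes "f \<in> faces T"
  shows "e edge_of f \<longleftrightarrow> e edge_of T \<and> e \<subseteq> f"
  using face_of_face[OF face_face_of[OF assms], of e] by (auto simp: edge_of_def)

lemma left_eq:
  fixes p q x :: "real^3"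
  shows "cross3 (q - p) (x - p) \<bullet> m = cross3 m (q - p) \<bullet> (x - p)"
  by (metis cross_triple)

text \<open>The cross product of two tangents is a multiple of the normal, so a vanishing triple
  product puts \<open>x\<close> on the line through \<open>p\<close> and \<open>q\<close>; the edge
  is all of \<open>f\<close> on that line.\<close>

lemma edge_side_zero:
  assumes f: "f \<in> faces T" and e: "closed_segment p q edge_of f" and "p \<noteq> q"
    and x: "x \<in> f" "cross3 (q - p) (x - p) \<bullet> normal T f = 0"
  shows "x \<in> closed_segment p q"
proof -
  have pq: "p \<in> f" "q \<in> f" using edge_of_imp_subset[OF e] by auto
  have "cross3 (q - p) (x - p) = (cross3 (q - p) (x - p) \<bullet> normal T f) *\<^sub>R normal T f"
    by (intro cross3_of_tangents norm_normal normal_orthogonal f pq x(1))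
  then have "cross3 (q - p) (x - p) = 0" using x(2) by simp
  then have "collinear {0, q - p, x - p}" by (simp add: cross_eq_0)
  then have "collinear {q, p, x}" by (subst collinear_3) auto
  then have "x \<in> affine hull {p, q}"
    using \<open>p \<noteq> q\<close> by (simp add: collinear_3_affine_hull[symmetric] insert_commute)
  then have "x \<in> affine hull (closed_segment p q)"
    by (simp add: segment_convex_hull affine_hull_convex_hull)
  moreover have "closed_segment p q = affine hull (closed_segment p q) \<inter> f"
    using face_of_imp_eq_affine_Int[OF convex_face[OF f], of "closed_segment p q"] e
    unfolding edge_of_def by blast
  ultimately show ?thesis using x(1) by auto
qed

text \<open>If \<open>f\<close> had points strictly on both sides, the segment between them would
  cross the line of the edge inside \<open>f\<close>, hence in the edge. As the edge is a face of
  \<open>f\<close>, it would contain both end points, which are off its line.\<close>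

lemma edge_side:
  assumes f: "f \<in> faces T" and e: "closed_segment p q edge_of f" and "p \<noteq> q"
  shows "(\<forall>x\<in>f. 0 \<le> cross3 (q - p) (x - p) \<bullet> normal T f) \<or> (\<forall>x\<in>f. cross3 (q - p) (x - p) \<bullet> normal T f \<le> 0)"
proof (rule ccontr)
  define m where "m = cross3 (normal T f) (q - p)"
  have L: "cross3 (q - p) (x - p) \<bullet> normal T f = m \<bullet> (x - p)" for x
    by (simp add: m_def left_eq)
  assume "\<not> ?thesis"
  then obtain x y where xy: "x \<in> f" "y \<in> f" "m \<bullet> (x - p) < 0" "0 < m \<bullet> (y - p)"
    by (auto simp: L not_le)
  define t where "t = (m \<bullet> (x - p)) / (m \<bullet> (x - p) - m \<bullet> (y - p))"
  define z where "z = (1 - t) *\<^sub>R x + t *\<^sub>R y"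
  have t: "0 < t" "t < 1" using xy by (auto simp: t_def divide_simps)
  have "m \<bullet> (z - p) = m \<bullet> (x - p) - t * (m \<bullet> (x - p) - m \<bullet> (y - p))"
    by (simp add: z_def algebra_simps)
  also have "\<dots> = 0" using xy by (simp add: t_def)
  finally have z0: "m \<bullet> (z - p) = 0" .
  have z: "z \<in> open_segment x y"
    using t xy by (auto simp: in_segment z_def)
  then have "z \<in> f"
    using convex_face[OF f] xy(1,2) by (meson convex_contains_open_segment subsetD)
  then have "z \<in> closed_segment p q"
    using edge_side_zero[OF f e \<open>p \<noteq> q\<close>] z0 by (simp add: L)
  then have "x \<in> closed_segment p q"
    using e face_ofD[OF _ z xy(1,2)] by (auto simp: edge_of_def)
  then obtain s where "x = (1 - s) *\<^sub>R p + s *\<^sub>R q" by (auto simp: in_segment)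
  then have "x - p = s *\<^sub>R (q - p)" by (simp add: algebra_simps)
  then have "m \<bullet> (x - p) = 0" by (simp add: m_def dot_cross_self)
  then show False using xy by simp
qed

lemma off_edge_point:
  assumes f: "f \<in> faces T" and e: "closed_segment p q edge_of f" and "p \<noteq> q"
  obtains x where "x \<in> f" "cross3 (q - p) (x - p) \<bullet> normal T f \<noteq> 0"
proof -
  have "f \<noteq> closed_segment p q"
    using aff_dim_face[OF f] e by (auto simp: edge_of_def)
  then obtain x where "x \<in> f" "x \<notin> closed_segment p q"
    using edge_of_imp_subset[OF e] by blast
  then show thesis using edge_side_zero[OF f e \<open>p \<noteq> q\<close>] that by blast
qed

text \<open>If both faces lie on the left of the directed edge, then each of the two outward normals gives
  a sign for the same triple product, and the two signs are opposite.\<close>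

lemma face_determined_by_directed_edge:
  assumes f: "f \<in> faces T" and g: "g \<in> faces T" and "p \<noteq> q"
    and e: "closed_segment p q edge_of f" "closed_segment p q edge_of g"
    and left: "\<forall>x\<in>f. 0 \<le> cross3 (q - p) (x - p) \<bullet> normal T f" "\<forall>x\<in>g. 0 \<le> cross3 (q - p) (x - p) \<bullet> normal T g"
  shows "f = g"
proof (rule face_eqI_subset[OF f g], rule subsetI)
  fix y assume y: "y \<in> f"
  have pq: "p \<in> f" "q \<in> f" "p \<in> g" "q \<in> g" using e edge_of_imp_subset by fastforce+
  obtain x where x: "x \<in> g" "cross3 (q - p) (x - p) \<bullet> normal T g \<noteq> 0"
    using off_edge_point[OF g e(2) \<open>p \<noteq> q\<close>] .
  define \<alpha> where "\<alpha> = cross3 (q - p) (x - p) \<bullet> normal T g"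
  define \<beta> where "\<beta> = cross3 (q - p) (y - p) \<bullet> normal T f"
  have \<alpha>: "\<alpha> > 0" using x left(2) by (auto simp: \<alpha>_def less_le)
  have \<beta>: "\<beta> \<ge> 0" using y left(1) by (auto simp: \<beta>_def)
  have cg: "cross3 (q - p) (x - p) = \<alpha> *\<^sub>R normal T g"
    unfolding \<alpha>_def by (intro cross3_of_tangents norm_normal normal_orthogonal g pq x(1))
  have cf: "cross3 (q - p) (y - p) = \<beta> *\<^sub>R normal T f"
    unfolding \<beta>_def by (intro cross3_of_tangents norm_normal normal_orthogonal f pq y)
  have le: "normal T g \<bullet> (y - p) \<le> 0" "normal T f \<bullet> (x - p) \<le> 0"
    using normal_le[OF g pq(3), of y] normal_le[OF f pq(1), of x] x y face_subset f g
    by (auto simp: inner_diff_right)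
  have "cross3 (q - p) (x - p) \<bullet> (y - p) = - (cross3 (q - p) (y - p) \<bullet> (x - p))"
    by (simp add: cross3_simps)
  then have "\<alpha> * (normal T g \<bullet> (y - p)) = - (\<beta> * (normal T f \<bullet> (x - p)))"
    by (simp add: cg cf)
  moreover have "\<beta> * (normal T f \<bullet> (x - p)) \<le> 0" using \<beta> le(2) by (simp add: mult_nonneg_nonpos)
  ultimately have "normal T g \<bullet> (y - p) \<ge> 0" using \<alpha> by (metis neg_0_le_iff_le zero_le_mult_iff not_le)
  with le(1) have "normal T g \<bullet> y = normal T g \<bullet> p" by (simp add: inner_diff_right)
  then show "y \<in> g" using normal_eq_iff[OF g pq(3)] y face_subset[OF f] by auto
qed

text \<open>A nonempty proper face of a polyhedron is the intersection of the facets containing it;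
  were there only one, the edge would have dimension two.\<close>

lemma two_faces_at_edge:
  assumes e: "e edge_of T"
  obtains f g where "f \<in> faces T" "g \<in> faces T" "f \<noteq> g" "e edge_of f" "e edge_of g"
proof -
  have e': "e face_of T" "aff_dim e = 1" using e by (auto simp: edge_of_def)
  then have "e \<noteq> {}" "e \<noteq> T" using aff_dim_body by auto
  then have eq: "e = \<Inter>{F. F facet_of T \<and> e \<subseteq> F}"
    using face_of_polyhedron[OF polyhedron e'(1)] by blast
  obtain f where f: "f \<in> faces T" "e \<subseteq> f"
    using face_of_polyhedron_subset_facet[OF polyhedron e'(1) \<open>e \<noteq> {}\<close> \<open>e \<noteq> T\<close>] by (auto simp: faces_def)
  have "e \<noteq> f" using aff_dim_face[OF f(1)] e'(2) by auto
  moreover have "e = f" if "\<forall>g\<in>faces T. e \<subseteq> g \<longrightarrow> g = f"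
  proof -
    have "{F. F facet_of T \<and> e \<subseteq> F} = {f}" using that f unfolding faces_def by blast
    then have "\<Inter>{F. F facet_of T \<and> e \<subseteq> F} = f" by simp
    then show ?thesis by (rule trans[OF eq])
  qed
  ultimately obtain g where "g \<in> faces T" "e \<subseteq> g" "g \<noteq> f" by blast
  then show thesis using that f e edge_of_face_iff by metis
qed

section \<open>Connectedness of the graph of faces\<close>

text \<open>The frontier is a topological sphere, so without one vertex \<open>a\<close> it is
  homeomorphic to a plane. The images of the other vertices are finitely many points, and a convex
  set that is not collinear stays connected when countably many points are removed.\<close>

lemma connected_frontier_minus_vertices: "connected (frontier T - {v. v extreme_point_of T})"
proof -
  let ?V = "{v. v extreme_point_of T}"
  have "T \<noteq> {}" using interior by auto
  then obtain a where a: "a extreme_point_of T"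
    using extreme_point_exists_convex[OF compact convex] by blast
  have ext: "?V \<subseteq> frontier T"
    using extreme_point_not_in_interior compact_imp_closed[OF compact]
    by (auto simp: frontier_def extreme_point_of_def)
  have rf: "rel_frontier T = frontier T" by (rule rel_frontier_nonempty_interior[OF interior])
  let ?H = "{x::real^3. axis 1 1 \<bullet> x = 0}"
  have dimH: "aff_dim ?H = 2" by (subst aff_dim_hyperplane) (auto simp: axis_eq_0_iff)
  have "rel_frontier T - {a} homeomorphic ?H"
    by (rule homeomorphic_punctured_sphere_affine_gen)
      (use compact convex a ext dimH aff_dim_body in \<open>auto simp: rf compact_imp_bounded affine_hyperplane\<close>)
  then obtain h k where hk: "homeomorphism (frontier T - {a}) ?H h k"
    by (auto simp: homeomorphic_def rf)
  have "countable (h ` (?V - {a}))"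
    using finite_polyhedron_extreme_points[OF polyhedron] by (simp add: countable_finite)
  moreover have "\<not> collinear ?H" using dimH by (simp add: collinear_aff_dim)
  ultimately have "connected (?H - h ` (?V - {a}))"
    by (intro connected_convex_diff_countable convex_hyperplane)
  moreover have "continuous_on (?H - h ` (?V - {a})) k"
    using hk by (auto simp: homeomorphism_def intro: continuous_on_subset)
  ultimately have "connected (k ` (?H - h ` (?V - {a})))"
    by (rule connected_continuous_image[rotated])
  moreover have "k ` (?H - h ` (?V - {a})) = frontier T - ?V"
  proof (intro equalityI subsetI)
    fix x assume "x \<in> k ` (?H - h ` (?V - {a}))"
    then obtain y where y: "x = k y" "y \<in> ?H" "y \<notin> h ` (?V - {a})" by auto
    have 1: "x \<in> frontier T - {a}" and 2: "h x = y"
      using hk y(1,2) unfolding homeomorphism_def by blast+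
    then show "x \<in> frontier T - ?V" using y(3) by auto
  next
    fix x assume x: "x \<in> frontier T - ?V"
    then have x': "x \<in> frontier T - {a}" using a by auto
    then have 1: "h x \<in> ?H" "k (h x) = x" using hk unfolding homeomorphism_def by blast+
    have "h x \<notin> h ` (?V - {a})"
    proof
      assume "h x \<in> h ` (?V - {a})"
      then obtain w where w: "w \<in> ?V" "w \<noteq> a" "h x = h w" by auto
      then have "k (h w) = w" using hk ext unfolding homeomorphism_def by blast
      with 1 w x show False by auto
    qed
    with 1 show "x \<in> k ` (?H - h ` (?V - {a}))" by (metis DiffI image_eqI)
  qed
  ultimately show ?thesis by simp
qed

text \<open>A point common to faces inside and outside \<open>S\<close> is a vertex, so the two unions would
  disconnect the frontier without the vertices.\<close>

lemma faces_edge_connected: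
  assumes S: "S \<subseteq> faces T" "S \<noteq> {}"
    and closed: "\<And>f g e. f \<in> S \<Longrightarrow> g \<in> faces T \<Longrightarrow> e edge_of f \<Longrightarrow> e edge_of g \<Longrightarrow> g \<in> S"
  shows "S = faces T"
proof (rule ccontr)
  let ?V = "{v. v extreme_point_of T}"
  assume "S \<noteq> faces T"
  then obtain g0 where g0: "g0 \<in> faces T" "g0 \<notin> S" using S by auto
  obtain f0 where f0: "f0 \<in> S" using S by auto
  define A where "A = \<Union>S"
  define B where "B = \<Union>(faces T - S)"
  have fin: "finite S" using finite_faces S(1) finite_subset by blast
  have "closed A" "closed B"
    unfolding A_def B_def using fin finite_faces S(1) compact_face compact_imp_closed
    by (auto intro!: closed_Union)
  moreover have "frontier T - ?V \<subseteq> A \<union> B"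
    unfolding A_def B_def using Union_faces by auto
  moreover have "A \<inter> B \<inter> (frontier T - ?V) = {}"
  proof -
    have "x extreme_point_of T" if x: "x \<in> f" "x \<in> g" "f \<in> S" "g \<in> faces T" "g \<notin> S" for x f g
    proof -
      have fg: "f \<in> faces T" "f \<noteq> g" using x S(1) by auto
      note I = aff_dim_Int_faces[OF fg(1) x(4) fg(2)]
      have "aff_dim (f \<inter> g) \<noteq> 1"
      proof
        assume "aff_dim (f \<inter> g) = 1"
        then have "(f \<inter> g) edge_of f" "(f \<inter> g) edge_of g"
          using I(2) edge_of_face_iff fg(1) x(4) by (auto simp: edge_of_def)
        with closed x show False by blast
      qed
      moreover have "\<not> aff_dim (f \<inter> g) < 0" using x by auto
      ultimately have "aff_dim (f \<inter> g) = 0" using I(1) by linarith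
      then obtain a where "f \<inter> g = {a}" by (auto simp: aff_dim_eq_0)
      moreover have "x \<in> f \<inter> g" using x by simp
      ultimately have "f \<inter> g = {x}" by simp
      with I(2) show ?thesis by (simp add: face_of_singleton)
    qed
    then show ?thesis unfolding A_def B_def by auto
  qed
  ultimately have "A \<inter> (frontier T - ?V) = {} \<or> B \<inter> (frontier T - ?V) = {}"
    using connected_frontier_minus_vertices unfolding connected_closed by blast
  \<comment> \<open>Both unions keep points after the vertices are removed: the midpoint of two
    distinct points of a face is not extreme.\<close>
  moreover have "\<exists>x. x \<in> f \<and> x \<in> frontier T - ?V" if f: "f \<in> faces T" for f
  proof -
    obtain p q where pq: "p \<in> f" "q \<in> f" "p \<noteq> q"
      using aff_dim_face[OF f] aff_dim_sing[of "_::real^3"]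
      by (metis face_nonempty[OF f] aff_dim_eq_0 is_singletonI' is_singleton_the_elem zero_neq_numeral)
    have mid: "midpoint p q \<in> open_segment p q" using pq(3) by simp
    then have "midpoint p q \<in> f"
      using convex_face[OF f] pq by (meson convex_contains_open_segment subsetD)
    moreover have "\<not> midpoint p q extreme_point_of T"
      using mid pq face_subset[OF f] unfolding extreme_point_of_def by blast
    ultimately show ?thesis using Union_faces f by auto
  qed
  ultimately show False
    using f0 g0 S(1) unfolding A_def B_def by blast
qed

end

section \<open>Oriented boundaries of the faces\<close>

text \<open>The columns are independent and lie in the span of \<open>card F\<close> unit functions,
  so a right-hand side outside their span would give one independent vector too many. An arbitrary
  finite index set spares numbering the faces.\<close>

lemma finite_square_system_solvable:
  fixes M :: "'a \<Rightarrow> 'a \<Rightarrow> real"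
  assumes F: "finite F"
    and inj: "\<And>c. (\<And>i. i \<in> F \<Longrightarrow> (\<Sum>j\<in>F. c j * M i j) = 0) \<Longrightarrow> (\<forall>j\<in>F. c j = 0)"
  shows "\<exists>c. \<forall>i\<in>F. (\<Sum>j\<in>F. c j * M i j) = b i"
proof -
  define col where "col j = (\<lambda>i. if i \<in> F then M i j else 0)" for j
  define b' where "b' = (\<lambda>i. if i \<in> F then b i else 0)"
  define e where "e k = (\<lambda>i::'a. if i = k then 1 else 0 :: real)" for k
  have comb: "(\<Sum>j\<in>F. c j *\<^sub>R col j) i = (if i \<in> F then \<Sum>j\<in>F. c j * M i j else 0)" for c i
    by (simp add: sum_fun_apply col_def)
  have indep: "\<forall>j\<in>F. c j = 0" if "(\<Sum>j\<in>F. c j *\<^sub>R col j) = 0" for c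
  proof (rule inj)
    fix i assume "i \<in> F"
    then show "(\<Sum>j\<in>F. c j * M i j) = 0" using comb[of c i] that by simp
  qed
  have injc: "inj_on col F"
  proof (rule inj_onI, rule ccontr)
    fix i j assume ij: "i \<in> F" "j \<in> F" "col i = col j" "i \<noteq> j"
    have "(\<Sum>k\<in>F. (e i k - e j k) *\<^sub>R col k) = (\<Sum>k\<in>F. e i k *\<^sub>R col k) - (\<Sum>k\<in>F. e j k *\<^sub>R col k)"
      by (simp add: scaleR_diff_left sum_subtractf)
    also have "\<dots> = col i - col j"
      using ij F by (simp add: e_def if_distrib[of "\<lambda>t. t *\<^sub>R _"] sum.delta cong: if_cong)
    finally have "e i i - e j i = 0" using indep ij by fastforce
    then show False using ij by (simp add: e_def)
  qed
  have colF: "independent (col ` F)"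
  proof
    assume "dependent (col ` F)"
    then obtain u where u: "\<exists>v\<in>col ` F. u v \<noteq> 0" "(\<Sum>v\<in>col ` F. u v *\<^sub>R v) = 0"
      using dependent_finite[of "col ` F"] F by auto
    then have "(\<Sum>j\<in>F. u (col j) *\<^sub>R col j) = 0" by (simp add: sum.reindex[OF injc] o_def)
    then show False using indep[of "\<lambda>j. u (col j)"] u(1) by auto
  qed
  have span_e: "g \<in> span (e ` F)" if "\<And>i. i \<notin> F \<Longrightarrow> g i = 0" for g :: "'a \<Rightarrow> real"
  proof -
    have "g = (\<Sum>k\<in>F. g k *\<^sub>R e k)"
      using that F by (auto simp: fun_eq_iff sum_fun_apply e_def if_distrib[of "\<lambda>t. _ * t"] sum.delta cong: if_cong)
    also have "\<dots> \<in> span (e ` F)" by (intro span_sum span_scale span_base) auto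
    finally show ?thesis .
  qed
  have "b' \<in> span (col ` F)"
  proof (rule ccontr)
    assume nb: "b' \<notin> span (col ` F)"
    have "independent (insert b' (col ` F))" by (intro independent_insertI nb colF)
    moreover have "insert b' (col ` F) \<subseteq> span (e ` F)"
      using span_e by (auto simp: b'_def col_def)
    ultimately have "card (insert b' (col ` F)) \<le> card (e ` F)"
      using independent_span_bound F by blast
    also have "\<dots> \<le> card F" using F by (rule card_image_le)
    finally have "card (insert b' (col ` F)) \<le> card F" .
    moreover have "b' \<notin> col ` F" using nb span_base[of b' "col ` F"] by metis
    ultimately show False using F by (simp add: card_image[OF injc])
  qed
  then obtain u where "b' = (\<Sum>v\<in>col ` F. u v *\<^sub>R v)"
    using F by (auto simp: span_finite)
  then have "b' = (\<Sum>j\<in>F. u (col j) *\<^sub>R col j)" by (simp add: sum.reindex[OF injc] o_def)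
  then have b'_apply: "b' i = (\<Sum>j\<in>F. u (col j) *\<^sub>R col j) i" for i by (rule fun_cong)
  have "(\<Sum>j\<in>F. u (col j) * M i j) = b i" if "i \<in> F" for i
    using trans[OF b'_apply[of i] comb[of "\<lambda>j. u (col j)" i]] that by (simp only: b'_def if_True)
  then show ?thesis by (intro exI[of _ "\<lambda>j. u (col j)"]) simp
qed

lemma sum_single_nonzero:
  assumes "finite A" "k \<in> A" "\<And>m. m \<in> A \<Longrightarrow> m \<noteq> k \<Longrightarrow> f m = 0"
  shows "sum f A = f k"
  using sum.remove[OF assms(1,2), of f] assms(3) by simp

section \<open>Directed edges and the faces on their left\<close>

locale whitney_polytope = solid_polytope +
  fixes n :: nat and v :: "nat \<Rightarrow> real^3" and lam :: "nat \<Rightarrow> real^3 \<Rightarrow> real" and C :: "nat \<Rightarrow> nat \<Rightarrow> nat \<Rightarrow> real"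
  assumes vertices: "bij_betw v {1..n} {p. p extreme_point_of T}"
    and bary: "barycentric_coords T {1..n} v lam"
    and coords: "coords_regular T n v lam"
    and faces_reg: "faces_regular T n v lam"
begin

abbreviation "\<E> \<equiv> edges T n v"
abbreviation "\<E>F \<equiv> face_diagonals T n v"
abbreviation "\<E>I \<equiv> inner_diagonals T n v"
abbreviation "bd \<equiv> oriented_boundary T n v"
abbreviation "D \<equiv> face_jacobian T lam"

lemma vertex_extreme: "i \<in> {1..n} \<Longrightarrow> v i extreme_point_of T"
  using vertices by (auto simp: bij_betw_def)

lemma extreme_vertex: "p extreme_point_of T \<Longrightarrow> \<exists>i\<in>{1..n}. p = v i"
  using vertices by (auto simp: bij_betw_def)

lemma vertex_eq_iff: "i \<in> {1..n} \<Longrightarrow> j \<in> {1..n} \<Longrightarrow> v i = v j \<longleftrightarrow> i = j"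
  using vertices by (auto simp: bij_betw_def dest: inj_onD)

lemma C1_lam: "i \<in> {1..n} \<Longrightarrow> C1_on T (lam i)"
  using coords by (simp add: coords_regular_def)

lemma finite_all_pairs: "finite (all_pairs n)"
  by (rule finite_subset[of _ "{1..n} \<times> {1..n}"]) (auto simp: all_pairs_def)

lemma edges_sym: "(i, j) \<in> \<E> \<Longrightarrow> (j, i) \<in> \<E>"
  by (auto simp: edges_def all_pairs_def seg_def closed_segment_commute)

lemma edges_range: "(i, j) \<in> \<E> \<Longrightarrow> i \<in> {1..n} \<and> j \<in> {1..n} \<and> i \<noteq> j"
  by (auto simp: edges_def all_pairs_def)

lemma diagonals_range:
  "(i, j) \<in> \<E>F \<Longrightarrow> i \<in> {1..n} \<and> j \<in> {1..n}" "(i, j) \<in> \<E>I \<Longrightarrow> i \<in> {1..n} \<and> j \<in> {1..n}"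
  by (auto simp: face_diagonals_def inner_diagonals_def all_pairs_def)

lemma edge_imp_seg:
  assumes "e edge_of T"
  obtains i j where "(i, j) \<in> \<E>" "e = seg v i j"
proof -
  obtain p q where pq: "p extreme_point_of T" "q extreme_point_of T" "p \<noteq> q" "e = closed_segment p q"
    using edge_ends[OF assms] .
  obtain i j where "i \<in> {1..n}" "j \<in> {1..n}" "p = v i" "q = v j"
    using extreme_vertex pq(1,2) by metis
  with pq assms show thesis
    by (intro that[of i j]) (auto simp: edges_def all_pairs_def seg_def)
qed

lemma boundary_imp_edge:
  assumes "f \<in> faces T" "(i, j) \<in> bd f"
  shows "(i, j) \<in> \<E>" "seg v i j edge_of f" "v i \<in> f" "v j \<in> f"
  using assms edge_of_face_iff[OF assms(1), of "seg v i j"]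
  by (auto simp: oriented_boundary_def edges_def seg_def)

lemma boundary_cases:
  assumes "f \<in> faces T" "(i, j) \<in> \<E>" "seg v i j \<subseteq> f"
  shows "(i, j) \<in> bd f \<or> (j, i) \<in> bd f"
proof -
  have e: "closed_segment (v i) (v j) edge_of f" "(i, j) \<in> all_pairs n" "(j, i) \<in> all_pairs n"
    using assms edge_of_face_iff[OF assms(1), of "seg v i j"] by (auto simp: edges_def seg_def all_pairs_def)
  have ne: "v i \<noteq> v j" using vertex_eq_iff edges_range[OF assms(2)] by auto
  have flip: "cross3 (v i - v j) (x - v j) \<bullet> m = - (cross3 (v j - v i) (x - v i) \<bullet> m)" for x m
    by (simp add: cross3_simps)
  from edge_side[OF assms(1) e(1) ne] show ?thesis
    using e by (auto simp: oriented_boundary_def seg_def closed_segment_commute flip)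
qed

lemma boundary_antisym:
  assumes f: "f \<in> faces T" and ij: "(i, j) \<in> bd f"
  shows "(j, i) \<notin> bd f"
proof
  assume ji: "(j, i) \<in> bd f"
  have ne: "v i \<noteq> v j" using vertex_eq_iff edges_range boundary_imp_edge(1)[OF f ij] by blast
  have e: "closed_segment (v i) (v j) edge_of f" using boundary_imp_edge(2)[OF f ij] by (simp add: seg_def)
  obtain x where x: "x \<in> f" "cross3 (v j - v i) (x - v i) \<bullet> normal T f \<noteq> 0"
    using off_edge_point[OF f e ne] .
  have "cross3 (v i - v j) (x - v j) \<bullet> m = - (cross3 (v j - v i) (x - v i) \<bullet> m)" for m
    by (simp add: cross3_simps)
  with x ij ji show False by (force simp: oriented_boundary_def)
qed

lemma boundary_determines_face:
  assumes "f \<in> faces T" "g \<in> faces T" "(i, j) \<in> bd f" "(i, j) \<in> bd g"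
  shows "f = g"
proof (rule face_determined_by_directed_edge)
  show "v i \<noteq> v j" using vertex_eq_iff edges_range boundary_imp_edge(1)[OF assms(1,3)] by blast
qed (use assms in \<open>auto simp: oriented_boundary_def seg_def\<close>)

text \<open>Each of the two faces at the edge traverses it in one of the two directions, and they
  cannot both use \<open>(j, i)\<close>, since a directed edge determines its face.\<close>

lemma boundary_exists:
  assumes "(i, j) \<in> \<E>"
  shows "\<exists>f\<in>faces T. (i, j) \<in> bd f"
proof -
  have "seg v i j edge_of T" using assms by (simp add: edges_def)
  then obtain f g where fg: "f \<in> faces T" "g \<in> faces T" "f \<noteq> g" "seg v i j edge_of f" "seg v i j edge_of g"
    using two_faces_at_edge by blast
  then show ?thesis
    using boundary_cases[OF fg(1) assms] boundary_cases[OF fg(2) assms] edge_of_imp_subset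
      boundary_determines_face[of f g j i] by blast
qed

lemma edge_of_both_imp_opposite:
  assumes "f \<in> faces T" "g \<in> faces T" "f \<noteq> g" "(i, j) \<in> bd g" "seg v i j edge_of f"
  shows "(j, i) \<in> bd f"
  using boundary_cases[OF assms(1) boundary_imp_edge(1)[OF assms(2,4)] edge_of_imp_subset[OF assms(5)]]
    boundary_determines_face assms by blast

lemma seg_boundary_inj:
  assumes "f \<in> faces T" "(i, j) \<in> bd f" "(k, l) \<in> bd f" "seg v i j = seg v k l"
  shows "i = k \<and> j = l"
proof -
  have "{v i, v j} = {v k, v l}" using assms(4) by (simp add: seg_def closed_segment_eq)
  moreover have "i \<in> {1..n}" "j \<in> {1..n}" "k \<in> {1..n}" "l \<in> {1..n}"
    using boundary_imp_edge(1) assms edges_range by blast+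
  ultimately have "(i = k \<and> j = l) \<or> (i = l \<and> j = k)"
    using vertex_eq_iff by (auto simp: doubleton_eq_iff)
  then show ?thesis using boundary_antisym[OF assms(1,2)] assms(3) by auto
qed

lemma finite_boundary: "finite (bd f)"
  by (rule finite_subset[OF _ finite_all_pairs]) (auto simp: oriented_boundary_def)

lemma card_edges_face:
  assumes f: "f \<in> faces T"
  shows "card {e. e edge_of f} = card (bd f)"
proof -
  have "{e. e edge_of f} = (\<lambda>(i, j). seg v i j) ` bd f"
  proof (intro equalityI subsetI)
    fix e assume "e \<in> {e. e edge_of f}"
    then have e: "e edge_of T" "e \<subseteq> f" using edge_of_face_iff[OF f] by auto
    then obtain i j where ij: "(i, j) \<in> \<E>" "e = seg v i j" using edge_imp_seg by blast
    from boundary_cases[OF f ij(1)] e(2) ij(2) obtain k l where kl: "(k, l) \<in> bd f" "e = seg v k l"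
      by (auto simp: seg_def closed_segment_commute)
    then show "e \<in> (\<lambda>(i, j). seg v i j) ` bd f" by force
  qed (use boundary_imp_edge(2)[OF f] in auto)
  moreover have "inj_on (\<lambda>(i, j). seg v i j) (bd f)"
    using seg_boundary_inj[OF f] by (auto simp: inj_on_def)
  ultimately show ?thesis by (simp add: card_image)
qed

text \<open>Passes from the undirected edges counted in \<open>face_matrix\<close> to the directed
  ones over which \<open>whitney_face\<close> sums: two faces traverse a shared edge in opposite
  directions.\<close>

lemma card_common_edges:
  assumes f: "f \<in> faces T" and g: "g \<in> faces T" and "f \<noteq> g"
  shows "card {e. e edge_of f \<and> e edge_of g} = card {(i, j) \<in> bd g. (j, i) \<in> bd f}"
proof -
  let ?P = "{(i, j) \<in> bd g. (j, i) \<in> bd f}"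
  have "{e. e edge_of f \<and> e edge_of g} = (\<lambda>(i, j). seg v i j) ` ?P"
  proof (intro equalityI subsetI)
    fix e assume e: "e \<in> {e. e edge_of f \<and> e edge_of g}"
    then have eT: "e edge_of T" "e \<subseteq> g" using edge_of_face_iff[OF g] by auto
    obtain i j where ij: "(i, j) \<in> \<E>" "e = seg v i j" using edge_imp_seg[OF eT(1)] .
    from boundary_cases[OF g ij(1)] eT(2) ij(2) obtain k l where kl: "(k, l) \<in> bd g" "e = seg v k l"
      by (auto simp: seg_def closed_segment_commute)
    then have "(k, l) \<in> ?P" using edge_of_both_imp_opposite[OF assms] e by auto
    then show "e \<in> (\<lambda>(i, j). seg v i j) ` ?P" using kl(2) by force
  next
    fix e assume "e \<in> (\<lambda>(i, j). seg v i j) ` ?P"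
    then obtain i j where "e = seg v i j" "(i, j) \<in> bd g" "(j, i) \<in> bd f" by auto
    then show "e \<in> {e. e edge_of f \<and> e edge_of g}"
      using boundary_imp_edge(2)[OF f, of j i] boundary_imp_edge(2)[OF g, of i j]
      by (simp add: seg_def closed_segment_commute)
  qed
  moreover have "inj_on (\<lambda>(i, j). seg v i j) ?P"
    using seg_boundary_inj[OF g] by (auto simp: inj_on_def)
  ultimately show ?thesis by (simp add: card_image)
qed

text \<open>The line through the two vertices supports \<open>f\<close> and cuts out a face of it;
  the point \<open>z\<close> off the line makes that face proper, hence of dimension at most one, so
  it is the segment between the vertices.\<close>

lemma supporting_edge:
  assumes f: "f \<in> faces T" and ij: "i \<in> {1..n}" "j \<in> {1..n}" "v i \<in> f" "v j \<in> f"
    and left: "\<And>x. x \<in> f \<Longrightarrow> 0 \<le> cross3 (v j - v i) (x - v i) \<bullet> normal T f"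
    and z: "z \<in> f" "0 < cross3 (v j - v i) (z - v i) \<bullet> normal T f"
  shows "(i, j) \<in> bd f"
proof -
  define m where "m = cross3 (normal T f) (v j - v i)"
  have L: "cross3 (v j - v i) (x - v i) \<bullet> normal T f = m \<bullet> x - m \<bullet> v i" for x
    by (simp add: m_def left_eq inner_diff_right)
  define H where "H = f \<inter> {x. m \<bullet> x = m \<bullet> v i}"
  have H: "H face_of f"
    unfolding H_def using left
    by (intro face_of_Int_supporting_hyperplane_ge convex_face f) (simp add: L)
  moreover have "z \<notin> H" using z by (simp add: H_def L)
  ultimately have "aff_dim H < aff_dim f" using face_of_aff_dim_lt[OF convex_face[OF f]] z(1) by blast
  then have dim: "aff_dim H \<le> 1" using aff_dim_face[OF f] by simp
  have HT: "H face_of T" using H face_face_of[OF f] face_of_trans by blast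
  have "m \<bullet> (v j - v i) = 0" by (simp add: m_def dot_cross_self)
  then have mem: "v i \<in> H" "v j \<in> H" using ij by (auto simp: H_def inner_diff_right)
  have "v i \<noteq> v j" using z(2) by auto
  note fs = face_eq_segment[OF HT dim vertex_extreme[OF ij(1)] mem(1) vertex_extreme[OF ij(2)] mem(2) this]
  have "H edge_of f" using fs(2) edge_of_face_iff[OF f] by (auto simp: H_def)
  then show ?thesis
    using fs(1) left ij \<open>v i \<noteq> v j\<close> by (auto simp: oriented_boundary_def seg_def all_pairs_def)
qed

section \<open>Boundaries of triangles and parallelograms\<close>

lemma vertex_of_hull_face:
  assumes f: "f \<in> faces T" "f = convex hull S" and i: "i \<in> {1..n}" "v i \<in> f"
  shows "v i \<in> S"
proof -
  have "v i extreme_point_of f"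
    using extreme_point_of_face[OF face_face_of[OF f(1)]] vertex_extreme i by auto
  then show ?thesis using f(2) extreme_point_of_convex_hull by auto
qed

lemma hull_left_of:
  fixes p q m :: "real^3"
  assumes "\<And>x. x \<in> S \<Longrightarrow> 0 \<le> cross3 (q - p) (x - p) \<bullet> m" "x \<in> convex hull S"
  shows "0 \<le> cross3 (q - p) (x - p) \<bullet> m"
proof -
  have "S \<subseteq> {x. cross3 m (q - p) \<bullet> p \<le> cross3 m (q - p) \<bullet> x}"
    using assms(1) by (auto simp: left_eq inner_diff_right)
  then have "convex hull S \<subseteq> {x. cross3 m (q - p) \<bullet> p \<le> cross3 m (q - p) \<bullet> x}"
    using convex_halfspace_ge[of "cross3 m (q - p) \<bullet> p" "cross3 m (q - p)"] by (intro hull_minimal) auto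
  then show ?thesis using assms(2) by (auto simp: left_eq inner_diff_right)
qed

lemma ccw_triangle_rotate:
  assumes "ccw_triangle T f a b c"
  shows "ccw_triangle T f b c a"
proof -
  have "cross3 (c - b) (a - b) = cross3 (b - a) (c - a)" by (simp add: cross3_simps)
  moreover have "{b, c, a} = {a, b, c}" by auto
  ultimately show ?thesis using assms unfolding ccw_triangle_def by metis
qed

lemma ccw_parallelogram_rotate:
  assumes "ccw_parallelogram T f a b c d"
  shows "ccw_parallelogram T f b c d a"
proof -
  have c: "c = b + d - a" using assms by (simp add: ccw_parallelogram_def algebra_simps)
  have "cross3 (c - b) (a - b) = cross3 (b - a) (d - a)" by (simp add: c cross3_simps)
  moreover have "{b, c, d, a} = {a, b, c, d}" "c - b = d - a" by (auto simp: c)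
  ultimately show ?thesis using assms unfolding ccw_parallelogram_def by metis
qed

lemma triangle_boundary1:
  assumes f: "f \<in> faces T" and r: "i \<in> {1..n}" "j \<in> {1..n}" "k \<in> {1..n}" and ccw: "ccw_triangle T f (v i) (v j) (v k)"
  shows "(i, j) \<in> bd f"
proof (rule supporting_edge[OF f r(1,2)])
  have hull: "f = convex hull {v i, v j, v k}" and pos: "0 < cross3 (v j - v i) (v k - v i) \<bullet> normal T f"
    using ccw by (auto simp: ccw_triangle_def)
  have S: "{v i, v j, v k} \<subseteq> f" unfolding hull by (rule hull_subset)
  then show "v i \<in> f" "v j \<in> f" "v k \<in> f" by auto
  show "0 \<le> cross3 (v j - v i) (x - v i) \<bullet> normal T f" if "x \<in> f" for x
    by (rule hull_left_of[of "{v i, v j, v k}"]) (use pos that hull in auto)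
  show "0 < cross3 (v j - v i) (v k - v i) \<bullet> normal T f" by fact
qed

lemma parallelogram_boundary1:
  assumes f: "f \<in> faces T" and r: "i \<in> {1..n}" "j \<in> {1..n}" "k \<in> {1..n}" "l \<in> {1..n}"
    and ccw: "ccw_parallelogram T f (v i) (v j) (v k) (v l)"
  shows "(i, j) \<in> bd f" "(i, k) \<notin> bd f"
proof -
  have hull: "f = convex hull {v i, v j, v k, v l}" and c: "v k = v j + v l - v i"
    and pos: "0 < cross3 (v j - v i) (v l - v i) \<bullet> normal T f"
    using ccw by (auto simp: ccw_parallelogram_def algebra_simps)
  have S: "{v i, v j, v k, v l} \<subseteq> f" unfolding hull by (rule hull_subset)
  have k: "cross3 (v j - v i) (v k - v i) = cross3 (v j - v i) (v l - v i)"
    by (simp add: c cross3_simps)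
  show "(i, j) \<in> bd f"
  proof (rule supporting_edge[OF f r(1,2)])
    show "v i \<in> f" "v j \<in> f" "v l \<in> f" using S by auto
    show "0 \<le> cross3 (v j - v i) (x - v i) \<bullet> normal T f" if "x \<in> f" for x
      by (rule hull_left_of[of "{v i, v j, v k, v l}"]) (use pos that hull k in auto)
    show "0 < cross3 (v j - v i) (v l - v i) \<bullet> normal T f" by fact
  qed
  \<comment> \<open>\<open>v j\<close> lies strictly to the right of the diagonal from
    \<open>v i\<close> to \<open>v k\<close>, which therefore is not a boundary edge.\<close>
  have "cross3 (v k - v i) (v j - v i) = - cross3 (v j - v i) (v l - v i)"
    by (simp add: c cross3_simps)
  then have "cross3 (v k - v i) (v j - v i) \<bullet> normal T f < 0" using pos by simp
  then show "(i, k) \<notin> bd f" using S by (force simp: oriented_boundary_def)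
qed

lemma triangle_face:
  assumes f: "f \<in> faces T" and r: "i \<in> {1..n}" "j \<in> {1..n}" "k \<in> {1..n}" and ccw: "ccw_triangle T f (v i) (v j) (v k)"
  shows "bd f = {(i, j), (j, k), (k, i)}" "{m \<in> {1..n}. v m \<in> f} = {i, j, k}"
proof -
  have hull: "f = convex hull {v i, v j, v k}" using ccw by (auto simp: ccw_triangle_def)
  then have S: "{v i, v j, v k} \<subseteq> f" using hull_subset by metis
  show V: "{m \<in> {1..n}. v m \<in> f} = {i, j, k}"
    using vertex_of_hull_face[OF f hull] S r vertex_eq_iff by auto
  have b: "(i, j) \<in> bd f" "(j, k) \<in> bd f" "(k, i) \<in> bd f"
    using triangle_boundary1[OF f] r ccw ccw_triangle_rotate by blast+
  have "p \<in> {(i, j), (j, k), (k, i)}" if "p \<in> bd f" for p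
  proof -
    obtain a c where p: "p = (a, c)" by (cases p)
    have "a \<in> {i, j, k}" "c \<in> {i, j, k}" "a \<noteq> c"
      using V boundary_imp_edge[OF f, of a c] edges_range[of a c] that p by auto
    then show ?thesis using b[THEN boundary_antisym[OF f]] that p by auto
  qed
  then show "bd f = {(i, j), (j, k), (k, i)}" using b by auto
qed

lemma parallelogram_face:
  assumes f: "f \<in> faces T" and r: "i \<in> {1..n}" "j \<in> {1..n}" "k \<in> {1..n}" "l \<in> {1..n}"
    and ccw: "ccw_parallelogram T f (v i) (v j) (v k) (v l)"
  shows "bd f = {(i, j), (j, k), (k, l), (l, i)}" "{m \<in> {1..n}. v m \<in> f} = {i, j, k, l}"
proof -
  have hull: "f = convex hull {v i, v j, v k, v l}" using ccw by (auto simp: ccw_parallelogram_def)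
  then have S: "{v i, v j, v k, v l} \<subseteq> f" using hull_subset by metis
  show V: "{m \<in> {1..n}. v m \<in> f} = {i, j, k, l}"
    using vertex_of_hull_face[OF f hull] S r vertex_eq_iff by auto
  \<comment> \<open>Rotating the labels turns the result for the first edge and the first diagonal
    into all four edges and both diagonals in both directions.\<close>
  note ccw2 = ccw_parallelogram_rotate[OF ccw]
  note ccw3 = ccw_parallelogram_rotate[OF ccw2]
  note ccw4 = ccw_parallelogram_rotate[OF ccw3]
  have b: "(i, j) \<in> bd f" "(j, k) \<in> bd f" "(k, l) \<in> bd f" "(l, i) \<in> bd f"
    and nb: "(i, k) \<notin> bd f" "(j, l) \<notin> bd f" "(k, i) \<notin> bd f" "(l, j) \<notin> bd f"
    using parallelogram_boundary1[OF f r ccw] parallelogram_boundary1[OF f r(2,3,4,1) ccw2]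
      parallelogram_boundary1[OF f r(3,4,1,2) ccw3] parallelogram_boundary1[OF f r(4,1,2,3) ccw4] by auto
  have "p \<in> {(i, j), (j, k), (k, l), (l, i)}" if "p \<in> bd f" for p
  proof -
    obtain a c where p: "p = (a, c)" by (cases p)
    have "a \<in> {i, j, k, l}" "c \<in> {i, j, k, l}" "a \<noteq> c"
      using V boundary_imp_edge[OF f, of a c] edges_range[of a c] that p by auto
    then show ?thesis using b[THEN boundary_antisym[OF f]] nb that p by auto
  qed
  then show "bd f = {(i, j), (j, k), (k, l), (l, i)}" using b by auto
qed

end

section \<open>Traces on the faces\<close>

text \<open>The derivative relative to \<open>f\<close> is that of the zero function, and it
  determines \<open>g\<close> along \<open>f\<close>. For a \<open>lam i\<close> vanishing on a
  face, this leaves only the normal part of the gradient.\<close>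

lemma gradient_const_on_zero_set:
  assumes "convex f" "f \<subseteq> S" "(u has_derivative (\<lambda>h. g \<bullet> h)) (at x within S)" "\<And>y. y \<in> f \<Longrightarrow> u y = 0"
    "x \<in> f" "y \<in> f"
  shows "g \<bullet> y = g \<bullet> x"
proof -
  have 1: "(u has_derivative (\<lambda>h. g \<bullet> h)) (at x within f)"
    using has_derivative_subset[OF assms(3,2)] .
  have "((\<lambda>_. 0) has_derivative (\<lambda>h. 0)) (at x within f)" by simp
  then have "(u has_derivative (\<lambda>h. 0)) (at x within f)"
    by (rule has_derivative_transform[rotated 2]) (use assms(4,5) in auto)
  then have 2: "(u has_derivative (\<lambda>h. 0 \<bullet> h)) (at x within f)" by simp
  have "g \<bullet> (y - x) = 0 \<bullet> (y - x)"
    by (rule has_derivative_within_convex_unique[OF assms(1,5,6) 1 2])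
  then show ?thesis by (simp add: inner_diff_right)
qed

context whitney_polytope
begin

lemma face_shape:
  assumes "f \<in> faces T"
  obtains (triangle) i j k where "i \<in> {1..n}" "j \<in> {1..n}" "k \<in> {1..n}" "ccw_triangle T f (v i) (v j) (v k)"
  | (parallelogram) i j k l where "i \<in> {1..n}" "j \<in> {1..n}" "k \<in> {1..n}" "l \<in> {1..n}"
      "ccw_parallelogram T f (v i) (v j) (v k) (v l)"
proof -
  have "(\<exists>i\<in>{1..n}. \<exists>j\<in>{1..n}. \<exists>k\<in>{1..n}. ccw_triangle T f (v i) (v j) (v k)) \<or>
      (\<exists>i\<in>{1..n}. \<exists>j\<in>{1..n}. \<exists>k\<in>{1..n}. \<exists>l\<in>{1..n}. ccw_parallelogram T f (v i) (v j) (v k) (v l))"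
    using bspec[OF faces_reg[unfolded faces_regular_def] assms] unfolding Let_def by (rule conjunct1)
  then show thesis by (elim disjE bexE) (rule that; assumption)+
qed

lemma triangle_jacobian:
  assumes "f \<in> faces T" "i \<in> {1..n}" "j \<in> {1..n}" "k \<in> {1..n}" "ccw_triangle T f (v i) (v j) (v k)" "x \<in> f"
  shows "D f i j x = 1 / (2 * area T f)"
  using faces_reg assms unfolding faces_regular_def Let_def by blast

lemma parallelogram_jacobian:
  assumes "f \<in> faces T" "i \<in> {1..n}" "j \<in> {1..n}" "k \<in> {1..n}" "l \<in> {1..n}"
    "ccw_parallelogram T f (v i) (v j) (v k) (v l)" "x \<in> f"
  shows "D f j k x + D f l i x = 1 / area T f"
  using faces_reg assms unfolding faces_regular_def Let_def by blast

text \<open>Rotating the labels makes any directed boundary edge the first one, so the trace is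
  computed for one position only.\<close>

lemma boundary_shape:
  assumes f: "f \<in> faces T" and ij: "(i, j) \<in> bd f"
  obtains (triangle) k where "k \<in> {1..n}" "ccw_triangle T f (v i) (v j) (v k)"
  | (parallelogram) k l where "k \<in> {1..n}" "l \<in> {1..n}" "ccw_parallelogram T f (v i) (v j) (v k) (v l)"
  using f
proof (cases rule: face_shape)
  case (triangle a b c)
  note r1 = ccw_triangle_rotate[OF triangle(4)]
  note r2 = ccw_triangle_rotate[OF r1]
  have "(i, j) \<in> {(a, b), (b, c), (c, a)}" using triangle_face(1)[OF f triangle] ij by simp
  then show thesis using triangle r1 r2 that(1) by auto
next
  case (parallelogram a b c d)
  note r1 = ccw_parallelogram_rotate[OF parallelogram(5)]
  note r2 = ccw_parallelogram_rotate[OF r1]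
  note r3 = ccw_parallelogram_rotate[OF r2]
  have "(i, j) \<in> {(a, b), (b, c), (c, d), (d, a)}" using parallelogram_face(1)[OF f parallelogram] ij by simp
  then show thesis using parallelogram r1 r2 r3 that(2) by auto
qed

lemma face_vertex_exists:
  assumes "f \<in> faces T"
  shows "\<exists>i\<in>{1..n}. v i \<in> f"
  using assms
proof (cases rule: face_shape)
  case (triangle i j k)
  then show ?thesis using triangle_face(2)[OF assms triangle] by blast
next
  case (parallelogram i j k l)
  then show ?thesis using parallelogram_face(2)[OF assms parallelogram] by blast
qed

lemma jacobian_skew: "D f j i x = - D f i j x"
  unfolding face_jacobian_def by (subst cross_skew) simp

lemma jacobian_off_face:
  assumes f: "f \<in> faces T" and x: "x \<in> f" and i: "i \<in> {1..n}" "v i \<notin> f"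
  shows "D f i j x = 0" "D f j i x = 0"
proof -
  have zero: "lam i y = 0" if "y \<in> f" for y
    using coords f i that by (auto simp: coords_regular_def Let_def)
  have xT: "x \<in> T" using face_subset f x by auto
  have "grad T (lam i) x \<bullet> y = grad T (lam i) x \<bullet> x" if "y \<in> f" for y
    by (rule gradient_const_on_zero_set[OF convex_face[OF f] face_subset[OF f]
          has_derivative_grad[OF convex interior C1_lam[OF i(1)] xT] zero x that])
  then obtain k where k: "grad T (lam i) x = k *\<^sub>R normal T f"
    using parallel_normal[OF f x] by blast
  show "D f i j x = 0" by (simp add: face_jacobian_def k cross_mult_left dot_cross_self)
  then show "D f j i x = 0" by (simp add: jacobian_skew[of f j i])
qed

lemma sum_grad_lam:
  assumes x: "x \<in> T"
  shows "(\<Sum>i\<in>{1..n}. grad T (lam i) x) = 0"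
proof -
  have one: "(\<Sum>i\<in>{1..n}. lam i y) = 1" if "y \<in> T" for y
  proof -
    have "affine_function (\<lambda>_. 1)" unfolding affine_function_def
      by (intro exI[of _ "\<lambda>_. 0"] exI[of _ 1]) (simp add: linear_zero)
    then show ?thesis using bary that by (force simp: barycentric_coords_def)
  qed
  have "((\<lambda>y. \<Sum>i\<in>{1..n}. lam i y) has_derivative (\<lambda>h. \<Sum>i\<in>{1..n}. grad T (lam i) x \<bullet> h)) (at x within T)"
    by (intro has_derivative_sum has_derivative_grad[OF convex interior C1_lam x])
  then have "((\<lambda>_. 1) has_derivative (\<lambda>h. (\<Sum>i\<in>{1..n}. grad T (lam i) x) \<bullet> h)) (at x within T)"
    by (intro has_derivative_transform[OF x, of "\<lambda>_. 1" "\<lambda>y. \<Sum>i\<in>{1..n}. lam i y"])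
      (simp_all only: one inner_sum_left)
  from grad_eqI[OF convex interior x this] have "grad T (\<lambda>_. 1) x = (\<Sum>i\<in>{1..n}. grad T (lam i) x)" .
  moreover have "grad T (\<lambda>_. 1) x = 0"
    by (rule grad_eqI[OF convex interior x]) simp
  ultimately show ?thesis by simp
qed

lemma sum_jacobian:
  assumes f: "f \<in> faces T" and x: "x \<in> f"
  shows "(\<Sum>j\<in>{1..n}. D f i j x) = 0"
proof -
  have xT: "x \<in> T" using face_subset f x by auto
  have "(\<Sum>j\<in>{1..n}. D f i j x) = (\<Sum>j\<in>{1..n}. cross3 (normal T f) (grad T (lam i) x) \<bullet> grad T (lam j) x)"
    unfolding face_jacobian_def by (intro sum.cong) (metis cross_triple)+
  also have "\<dots> = cross3 (normal T f) (grad T (lam i) x) \<bullet> (\<Sum>j\<in>{1..n}. grad T (lam j) x)"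
    by (simp add: inner_sum_right)
  finally show ?thesis using sum_grad_lam[OF xT] by simp
qed

lemma adjacent_vertices_sym: "adjacent_vertices T n v i j = adjacent_vertices T n v j i"
  by (simp add: adjacent_vertices_def seg_def closed_segment_commute)

lemma edge_in_face:
  assumes "f \<in> faces T" "(i, k) \<in> \<E>" "v i \<in> f" "v k \<in> f"
  shows "seg v i k \<subseteq> f"
  using convex_face[OF assms(1)] assms(3,4) by (simp add: seg_def closed_segment_subset)

lemma inner_diagonal_off_face:
  assumes f: "f \<in> faces T" and ik: "(i, k) \<in> \<E>I"
  shows "v i \<notin> f \<or> v k \<notin> f"
proof (rule ccontr)
  assume "\<not> ?thesis"
  then have "seg v i k \<subseteq> f" using convex_face[OF f] by (simp add: seg_def closed_segment_subset)
  then have "seg v i k \<subseteq> frontier T" using Union_faces f by auto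
  then show False using ik by (auto simp: inner_diagonals_def face_diagonals_def)
qed

lemma jacobian_inner_diagonal:
  assumes "f \<in> faces T" "x \<in> f" "(i, k) \<in> \<E>I"
  shows "D f i k x = 0"
  using inner_diagonal_off_face[OF assms(1,3)] jacobian_off_face[OF assms(1,2)] diagonals_range(2)[OF assms(3)]
  by blast

text \<open>A diagonal from \<open>v i\<close> lying both in \<open>f\<close> and in a face at the edge \<open>(i, j)\<close> would be the
  intersection of two distinct faces, hence an edge.\<close>

lemma jacobian_adjacent_diagonal:
  assumes f: "f \<in> faces T" and x: "x \<in> f" and j: "v j \<notin> f"
    and k: "k \<in> adjacent_vertices T n v i j" "(i, k) \<in> \<E>F"
  shows "D f i k x = 0"
proof (cases "v i \<in> f \<and> v k \<in> f")
  case False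
  then show ?thesis using jacobian_off_face[OF f x] diagonals_range(1)[OF k(2)] by blast
next
  case True
  obtain g where g: "g \<in> faces T" "seg v i j edge_of g" "v k \<in> g"
    using k(1) by (auto simp: adjacent_vertices_def)
  then have "v i \<in> g" "v j \<in> g" using edge_of_imp_subset by (fastforce simp: seg_def)+
  then have "f \<noteq> g" using j by auto
  have r: "i \<in> {1..n}" "k \<in> {1..n}" "(i, k) \<in> all_pairs n" "(i, k) \<notin> \<E>"
    using k(2) by (auto simp: face_diagonals_def all_pairs_def)
  then have "v i \<noteq> v k" using vertex_eq_iff by (auto simp: all_pairs_def)
  note I = aff_dim_Int_faces[OF f g(1) \<open>f \<noteq> g\<close>]
  have "f \<inter> g = seg v i k" "(f \<inter> g) edge_of T"
    using face_eq_segment[OF I(2,1) vertex_extreme[OF r(1)] _ vertex_extreme[OF r(2)] _ \<open>v i \<noteq> v k\<close>]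
      True g(3) \<open>v i \<in> g\<close> by (auto simp: seg_def)
  then have "(i, k) \<in> \<E>" using r(3) by (simp add: edges_def)
  with r(4) show ?thesis by simp
qed

section \<open>Normal traces of the corrected forms\<close>

text \<open>The normal component on \<open>f\<close> of the curl of the corrected form, as
  \<open>curl_Wt_trace\<close> confirms; the leading \<open>2\<close> is the one in the curl of a
  Whitney form.\<close>

definition edge_trace :: "(real^3) set \<Rightarrow> real^3 \<Rightarrow> nat \<Rightarrow> nat \<Rightarrow> real" where
  "edge_trace f x i j = 2 * (D f i j x
     + (1/2) * ((\<Sum>k | k \<in> adjacent_vertices T n v i j \<and> (i, k) \<in> \<E>F. D f i k x)
        - (\<Sum>k | k \<in> adjacent_vertices T n v i j \<and> (j, k) \<in> \<E>F. D f j k x))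
     + (1/2) * ((\<Sum>k | (i, k) \<in> \<E>I. C i k j * D f i k x) - (\<Sum>k | (j, k) \<in> \<E>I. C j k i * D f j k x)))"

lemma edge_trace_skew: "edge_trace f x j i = - edge_trace f x i j"
  by (simp add: edge_trace_def adjacent_vertices_sym[of j i] jacobian_skew[of f j i] algebra_simps)

lemma edge_trace_simp:
  assumes "f \<in> faces T" "x \<in> f"
  shows "edge_trace f x i j = 2 * D f i j x
     + (\<Sum>k | k \<in> adjacent_vertices T n v i j \<and> (i, k) \<in> \<E>F. D f i k x)
     - (\<Sum>k | k \<in> adjacent_vertices T n v i j \<and> (j, k) \<in> \<E>F. D f j k x)"
  unfolding edge_trace_def using jacobian_inner_diagonal[OF assms] by simp

lemma edge_trace_off_face:
  assumes f: "f \<in> faces T" and x: "x \<in> f" and ij: "(i, j) \<in> \<E>" and off: "v i \<notin> f \<or> v j \<notin> f"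
  shows "edge_trace f x i j = 0"
proof -
  have J0: "D f a k x = 0" if "a \<in> {1..n}" "v a \<notin> f" for a k
    using jacobian_off_face[OF f x that] by simp
  have 1: "D f i k x = 0" if "k \<in> adjacent_vertices T n v i j" "(i, k) \<in> \<E>F" for k
    using off J0 edges_range[OF ij] jacobian_adjacent_diagonal[OF f x _ that] by blast
  have 2: "D f j k x = 0" if "k \<in> adjacent_vertices T n v i j" "(j, k) \<in> \<E>F" for k
    using off J0 edges_range[OF ij] jacobian_adjacent_diagonal[OF f x, of i k j] that
      adjacent_vertices_sym by blast
  have "D f i j x = 0" using off J0[of i j] J0[of j i] edges_range[OF ij] jacobian_skew[of f i j] by auto
  then show ?thesis using 1 2 by (simp add: edge_trace_simp[OF f x])
qed

text \<open>In a triangle no diagonal survives, and twice \<open>D f i j x\<close> is already the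
  value. In a parallelogram each end contributes the diagonal to the vertex opposite to it, and the
  zero row sums trade these for the Jacobians of the two edges adjacent to \<open>(i, j)\<close>,
  whose sum is prescribed.\<close>

lemma edge_trace_boundary:
  assumes f: "f \<in> faces T" and x: "x \<in> f" and ij: "(i, j) \<in> bd f"
  shows "edge_trace f x i j = 1 / area T f"
proof -
  note e = boundary_imp_edge[OF f ij]
  have r: "i \<in> {1..n}" "j \<in> {1..n}" "i \<noteq> j" using edges_range[OF e(1)] by auto
  have J0: "D f a m x = 0" if "m \<in> {1..n}" "v m \<notin> f" for a m
    using jacobian_off_face[OF f x that] by simp
  have Jaa: "D f a a x = 0" for a by (simp add: face_jacobian_def)
  have edge_notin: "(a, b) \<notin> \<E>F" if "(a, b) \<in> bd f \<or> (b, a) \<in> bd f \<or> a = b" for a b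
    using that boundary_imp_edge(1)[OF f] edges_sym by (auto simp: face_diagonals_def all_pairs_def)
  from f ij show ?thesis
  proof (cases rule: boundary_shape)
    case (triangle k)
    note tf = triangle_face[OF f r(1,2) triangle]
    have "D f a m x = 0" if "(a, m) \<in> \<E>F" "a \<in> {i, j}" for a m
    proof (cases "v m \<in> f")
      case True
      then have "m \<in> {i, j, k}" using tf(2) diagonals_range(1)[OF that(1)] by auto
      then show ?thesis using edge_notin[of a m] that tf(1) by auto
    qed (use J0 diagonals_range(1)[OF that(1)] in auto)
    then show ?thesis
      using triangle_jacobian[OF f r(1,2) triangle x] by (simp add: edge_trace_simp[OF f x])
  next
    case (parallelogram k l)
    note pf = parallelogram_face[OF f r(1,2) parallelogram]
    have kl: "k \<in> {1..n}" "l \<in> {1..n}" by fact+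
    have mem: "v i \<in> f" "v j \<in> f" "v k \<in> f" "v l \<in> f" using pf(2) by auto
    \<comment> \<open>If \<open>k = i\<close>, then \<open>(j, k)\<close> would reverse
      \<open>(i, j)\<close>; if \<open>l = j\<close>, then \<open>(k, l)\<close> would reverse
      \<open>(j, k)\<close>.\<close>
    have "distinct [i, j, k, l]"
    proof -
      have "i \<noteq> j \<and> j \<noteq> k \<and> k \<noteq> l \<and> l \<noteq> i"
        using pf(1) boundary_imp_edge(1)[OF f] edges_range by blast
      moreover have "(j, i) \<notin> bd f" "(k, j) \<notin> bd f" using boundary_antisym[OF f] pf(1) by auto
      ultimately show ?thesis using pf(1) by auto
    qed
    then have dist: "i \<noteq> k" "j \<noteq> l" "i \<noteq> j" "j \<noteq> k" "k \<noteq> l" "i \<noteq> l" by auto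
    have diag: "(a, b) \<in> \<E>F"
      if ab: "a \<in> {1..n}" "b \<in> {1..n}" "v a \<in> f" "v b \<in> f" "a \<noteq> b" "(a, b) \<notin> bd f" "(b, a) \<notin> bd f" for a b
    proof -
      have s: "seg v a b \<subseteq> f" using convex_face[OF f] ab by (simp add: seg_def closed_segment_subset)
      then have "(a, b) \<notin> \<E>" using boundary_cases[OF f] ab(6,7) by blast
      moreover have "seg v a b \<subseteq> frontier T" using s Union_faces f by auto
      ultimately show ?thesis using ab by (auto simp: face_diagonals_def all_pairs_def)
    qed
    have adj: "m \<in> adjacent_vertices T n v i j" if "m \<in> {1..n}" "v m \<in> f" for m
      using that e(2) f by (auto simp: adjacent_vertices_def)
    have adj_range: "adjacent_vertices T n v i j \<subseteq> {1..n}" by (auto simp: adjacent_vertices_def)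
    have s1: "(\<Sum>m | m \<in> adjacent_vertices T n v i j \<and> (i, m) \<in> \<E>F. D f i m x) = D f i k x"
    proof (rule sum_single_nonzero)
      show "finite {m. m \<in> adjacent_vertices T n v i j \<and> (i, m) \<in> \<E>F}"
        by (rule finite_subset[of _ "{1..n}"]) (use adj_range in auto)
      show "k \<in> {m. m \<in> adjacent_vertices T n v i j \<and> (i, m) \<in> \<E>F}"
        using adj mem kl r dist diag[of i k] pf(1) by auto
      show "D f i m x = 0" if "m \<in> {m. m \<in> adjacent_vertices T n v i j \<and> (i, m) \<in> \<E>F}" "m \<noteq> k" for m
      proof (cases "v m \<in> f")
        case True
        then have "m \<in> {i, j, k, l}" using that adj_range unfolding pf(2)[symmetric] by auto
        then show ?thesis using edge_notin[of i m] that pf(1) by auto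
      qed (use J0 that adj_range in auto)
    qed
    have s2: "(\<Sum>m | m \<in> adjacent_vertices T n v i j \<and> (j, m) \<in> \<E>F. D f j m x) = D f j l x"
    proof (rule sum_single_nonzero)
      show "finite {m. m \<in> adjacent_vertices T n v i j \<and> (j, m) \<in> \<E>F}"
        by (rule finite_subset[of _ "{1..n}"]) (use adj_range in auto)
      show "l \<in> {m. m \<in> adjacent_vertices T n v i j \<and> (j, m) \<in> \<E>F}"
        using adj mem kl r dist diag[of j l] pf(1) by auto
      show "D f j m x = 0" if "m \<in> {m. m \<in> adjacent_vertices T n v i j \<and> (j, m) \<in> \<E>F}" "m \<noteq> l" for m
      proof (cases "v m \<in> f")
        case True
        then have "m \<in> {i, j, k, l}" using that adj_range unfolding pf(2)[symmetric] by auto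
        then show ?thesis using edge_notin[of j m] that pf(1) by auto
      qed (use J0 that adj_range in auto)
    qed
    have sum4: "D f a i x + D f a j x + D f a k x + D f a l x = 0" for a
    proof -
      have "(\<Sum>m\<in>{1..n}. D f a m x) = (\<Sum>m\<in>{i, j, k, l}. D f a m x)"
        using r kl J0 by (intro sum.mono_neutral_right) (auto simp flip: pf(2))
      then show ?thesis using sum_jacobian[OF f x, of a] dist by simp
    qed
    have "D f i j x + D f i k x + D f i l x = 0" "D f j i x + D f j k x + D f j l x = 0"
      using sum4[of i] sum4[of j] Jaa by auto
    moreover have "D f j k x + D f l i x = 1 / area T f"
      using parallelogram_jacobian[OF f r(1,2) parallelogram x] .
    moreover have "D f l i x = - D f i l x" "D f j i x = - D f i j x"
      by (rule jacobian_skew)+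
    \<comment> \<open>The trace splits into \<open>D f i j x + D f i k x = D f l i x\<close> and
      \<open>D f i j x - D f j l x = D f j k x\<close>.\<close>
    ultimately show ?thesis unfolding edge_trace_simp[OF f x] s1 s2 by linarith
  qed
qed

lemma edge_trace_eq:
  assumes f: "f \<in> faces T" and x: "x \<in> f" and ij: "(i, j) \<in> \<E>"
  shows "edge_trace f x i j = (if (i, j) \<in> bd f then 1 else if (j, i) \<in> bd f then -1 else 0) / area T f"
proof (cases "v i \<in> f \<and> v j \<in> f")
  case True
  then have "(i, j) \<in> bd f \<or> (j, i) \<in> bd f"
    using boundary_cases[OF f ij edge_in_face[OF f ij]] by auto
  then show ?thesis
    using edge_trace_boundary[OF f x] edge_trace_skew[of f x i j] boundary_antisym[OF f] by auto
next
  case False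
  then have "(i, j) \<notin> bd f" "(j, i) \<notin> bd f" using boundary_imp_edge[OF f] by blast+
  with False show ?thesis using edge_trace_off_face[OF f x ij] by auto
qed

end

section \<open>The Laplacian of the faces\<close>

lemma sum_split_scaled:
  fixes c :: "'a \<Rightarrow> real" and \<Phi> :: "'a \<Rightarrow> 'b::real_vector"
  shows "(\<Sum>g\<in>A. (c g - (\<Sum>h\<in>B. t h * d h g)) *\<^sub>R \<Phi> g)
    = (\<Sum>g\<in>A. c g *\<^sub>R \<Phi> g) - (\<Sum>h\<in>B. t h *\<^sub>R (\<Sum>g\<in>A. d h g *\<^sub>R \<Phi> g))"
  by (simp add: scaleR_diff_left sum_subtractf scaleR_sum_left scaleR_sum_right sum.swap[of _ B A])

context whitney_polytope
begin

section \<open>Curls and traces of the face fields\<close>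

definition curl_W :: "nat \<Rightarrow> nat \<Rightarrow> real^3 \<Rightarrow> real^3" where
  "curl_W i j = (\<lambda>x. if x \<in> T then 2 *\<^sub>R cross3 (grad T (lam i) x) (grad T (lam j) x) else 0)"

definition curl_Wt :: "nat \<Rightarrow> nat \<Rightarrow> real^3 \<Rightarrow> real^3" where
  "curl_Wt i j = curl_W i j
     + (1/2) *\<^sub>R ((\<Sum>k | k \<in> adjacent_vertices T n v i j \<and> (i, k) \<in> \<E>F. curl_W i k)
        - (\<Sum>k | k \<in> adjacent_vertices T n v i j \<and> (j, k) \<in> \<E>F. curl_W j k))
     + (1/2) *\<^sub>R ((\<Sum>k | (i, k) \<in> \<E>I. C i k j *\<^sub>R curl_W i k) - (\<Sum>k | (j, k) \<in> \<E>I. C j k i *\<^sub>R curl_W j k))"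

abbreviation face_curl :: "(real^3) set \<Rightarrow> real^3 \<Rightarrow> real^3" where
  "face_curl f \<equiv> curl T (whitney_face T n v lam C f)"

lemma has_curl_W:
  assumes "i \<in> {1..n}" "j \<in> {1..n}"
  shows "has_curl T (whitney T lam i j) (curl_W i j)"
  unfolding curl_W_def by (rule has_curl_whitney[OF compact convex interior]) (use C1_lam assms in auto)

lemma has_curl_Wt:
  assumes "(i, j) \<in> \<E>"
  shows "has_curl T (whitney_tilde T n v lam C i j) (curl_Wt i j)"
  unfolding whitney_tilde_def curl_Wt_def Let_def
  using edges_range[OF assms] diagonals_range
  by (intro has_curl_add has_curl_diff has_curl_scaleR has_curl_sum has_curl_W compact) blast+

lemma face_curl_eq:
  assumes "f \<in> faces T"
  shows "face_curl f = (\<Sum>(i, j)\<in>bd f. curl_Wt i j)"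
proof -
  have "has_curl T (whitney_face T n v lam C f) (\<Sum>(i, j)\<in>bd f. curl_Wt i j)"
    unfolding whitney_face_def case_prod_unfold
    using has_curl_Wt boundary_imp_edge(1)[OF assms]
    by (intro has_curl_sum compact) (metis prod.collapse)
  then show ?thesis by (rule has_curl_imp_curl[OF compact convex interior])
qed

lemma curl_W_skew: "curl_W j i = - curl_W i j"
  using cross_skew[of "grad T (lam j) x" "grad T (lam i) x" for x] by (auto simp: curl_W_def fun_eq_iff)

lemma curl_Wt_skew: "curl_Wt j i = - curl_Wt i j"
  by (simp add: curl_Wt_def adjacent_vertices_sym[of j i] curl_W_skew[of j i] algebra_simps)

lemma curl_Wt_trace:
  assumes "f \<in> faces T" "x \<in> f"
  shows "curl_Wt i j x \<bullet> normal T f = edge_trace f x i j"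
proof -
  have "x \<in> T" using face_subset assms by auto
  then have "curl_W a b x \<bullet> normal T f = 2 * D f a b x" for a b
    by (simp add: curl_W_def face_jacobian_def)
  then show ?thesis
    by (simp add: curl_Wt_def edge_trace_def sum_fun_apply inner_add_left inner_diff_left inner_sum_left
        algebra_simps sum_distrib_left)
qed

lemma boundary_disjoint:
  assumes "f \<in> faces T" "g \<in> faces T" "f \<noteq> g"
  shows "bd f \<inter> bd g = {}"
proof (rule ccontr)
  assume "\<not> ?thesis"
  then obtain i j where "(i, j) \<in> bd f" "(i, j) \<in> bd g" by auto
  with boundary_determines_face assms show False by blast
qed

lemma face_curl_trace:
  assumes f: "f \<in> faces T" and g: "g \<in> faces T" and x: "x \<in> f"
  shows "face_curl g x \<bullet> normal T f = face_matrix T f g"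
proof -
  let ?s = "\<lambda>(i, j). if (i, j) \<in> bd f then 1 else if (j, i) \<in> bd f then -1 else 0 :: real"
  have "face_curl g x \<bullet> normal T f = (\<Sum>(i, j)\<in>bd g. edge_trace f x i j)"
    by (simp add: face_curl_eq[OF g] sum_fun_apply inner_sum_left case_prod_unfold curl_Wt_trace[OF f x])
  also have "\<dots> = (\<Sum>p\<in>bd g. ?s p / area T f)"
    using edge_trace_eq[OF f x] boundary_imp_edge(1)[OF g] by (intro sum.cong) auto
  also have "\<dots> = (\<Sum>p\<in>bd g. ?s p) / area T f" by (simp only: sum_divide_distrib)
  also have "(\<Sum>p\<in>bd g. ?s p) = (if g = f then real (card {e. e edge_of f}) else - real (card {e. e edge_of f \<and> e edge_of g}))"
  proof (cases "g = f")
    case True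
    have "(\<Sum>p\<in>bd f. ?s p) = (\<Sum>p\<in>bd f. 1)" by (intro sum.cong) auto
    then show ?thesis using True card_edges_face[OF f] by simp
  next
    case False
    let ?P = "{(i, j) \<in> bd g. (j, i) \<in> bd f}"
    have "(\<Sum>p\<in>bd g. ?s p) = (\<Sum>p\<in>bd g. if p \<in> ?P then -1 else 0)"
    proof (intro sum.cong refl)
      fix p assume p: "p \<in> bd g"
      obtain i j where ij: "p = (i, j)" by (cases p)
      have "(i, j) \<notin> bd f" using boundary_disjoint[OF f g] False p ij by auto
      then show "?s p = (if p \<in> ?P then -1 else 0)" using p by (simp add: ij)
    qed
    also have "\<dots> = (\<Sum>p\<in>bd g \<inter> ?P. -1)"
      by (rule sum.inter_restrict[OF finite_boundary, symmetric])
    also have "bd g \<inter> ?P = ?P" by auto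
    finally show ?thesis using False card_common_edges[OF f g] by simp
  qed
  finally show ?thesis by (simp add: face_matrix_def)
qed

text \<open>The boundaries of the faces partition the directed edges, and reversing an edge negates
  its field, so the terms cancel in pairs. The cancellation happens in the fields themselves, which
  is what \<open>field_eq_0\<close> depends on.\<close>

lemma sum_face_curl: "(\<Sum>f\<in>faces T. face_curl f) = 0"
proof -
  have E: "\<E> = (\<Union>f\<in>faces T. bd f)"
    using boundary_exists boundary_imp_edge(1) by auto
  have "(\<Sum>f\<in>faces T. face_curl f) = (\<Sum>f\<in>faces T. \<Sum>(i, j)\<in>bd f. curl_Wt i j)"
    by (intro sum.cong face_curl_eq) auto
  also have "\<dots> = (\<Sum>(i, j)\<in>\<E>. curl_Wt i j)"
    unfolding E
    by (rule sum.UNION_disjoint[symmetric]) (use finite_faces finite_boundary boundary_disjoint in auto)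
  finally have sumE: "(\<Sum>f\<in>faces T. face_curl f) = (\<Sum>(i, j)\<in>\<E>. curl_Wt i j)" .
  have "(\<Sum>(i, j)\<in>\<E>. curl_Wt i j) = (\<Sum>(i, j)\<in>\<E>. curl_Wt j i)"
    by (rule sum.reindex_bij_witness[of _ prod.swap prod.swap]) (use edges_sym in auto)
  also have "\<dots> = - (\<Sum>(i, j)\<in>\<E>. curl_Wt i j)"
  proof -
    have "(\<lambda>(i, j). curl_Wt j i) = (\<lambda>p. - (case p of (i, j) \<Rightarrow> curl_Wt i j))"
      by (rule ext) (simp add: case_prod_unfold curl_Wt_skew[symmetric])
    then show ?thesis by (simp only: sum_negf)
  qed
  finally have "2 *\<^sub>R (\<Sum>(i, j)\<in>\<E>. curl_Wt i j) = 0"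
    by (simp add: scaleR_2 eq_neg_iff_add_eq_0)
  then show ?thesis using sumE by simp
qed

lemma sum_face_matrix_row:
  assumes "f \<in> faces T"
  shows "(\<Sum>g\<in>faces T. face_matrix T f g) = 0"
proof -
  obtain x where x: "x \<in> f" using face_nonempty[OF assms] by auto
  have "(\<Sum>g\<in>faces T. face_matrix T f g) = (\<Sum>g\<in>faces T. face_curl g) x \<bullet> normal T f"
    using face_curl_trace[OF assms _ x] by (simp add: sum_fun_apply inner_sum_left)
  then show ?thesis by (simp add: sum_face_curl)
qed

section \<open>The area-weighted matrix and its kernel\<close>

lemma area_face_matrix:
  assumes "f \<in> faces T"
  shows "area T f * face_matrix T f g
    = (if g = f then real (card {e. e edge_of f}) else - real (card {e. e edge_of f \<and> e edge_of g}))"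
  using area_pos[OF assms] by (simp add: face_matrix_def)

lemma area_face_matrix_sym:
  assumes "f \<in> faces T" "g \<in> faces T"
  shows "area T f * face_matrix T f g = area T g * face_matrix T g f"
proof -
  have "{e. e edge_of f \<and> e edge_of g} = {e. e edge_of g \<and> e edge_of f}" by auto
  then show ?thesis using assms by (simp add: area_face_matrix)
qed

text \<open>A discrete divergence theorem: the total flux of a curl through the frontier is zero.
  Symmetry after weighting by the areas reduces it to the row sums.\<close>

lemma sum_face_matrix_column:
  assumes "g \<in> faces T"
  shows "(\<Sum>f\<in>faces T. area T f * face_matrix T f g) = 0"
proof -
  have "(\<Sum>f\<in>faces T. area T f * face_matrix T f g) = (\<Sum>f\<in>faces T. area T g * face_matrix T g f)"
    using area_face_matrix_sym assms by (intro sum.cong) auto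
  then show ?thesis using sum_face_matrix_row[OF assms] by (simp flip: sum_distrib_left)
qed

lemma finite_edges_face: "f \<in> faces T \<Longrightarrow> finite {e. e edge_of f}"
  using finite_polytope_faces[OF face_of_polytope_polytope[OF polytope face_face_of]]
  by (rule rev_finite_subset) (auto simp: edge_of_def)

text \<open>Scaled by the areas, the matrix is the Laplacian of the graph of faces joined along edges, and a
  kernel vector is constant by the maximum principle.\<close>

lemma face_matrix_kernel:
  assumes ker: "\<And>f. f \<in> faces T \<Longrightarrow> (\<Sum>g\<in>faces T. c g * face_matrix T f g) = 0"
  shows "\<exists>k. \<forall>g\<in>faces T. c g = k"
proof -
  define m where "m = Max (c ` faces T)"
  have le: "c g \<le> m" if "g \<in> faces T" for g
    using finite_faces that by (simp add: m_def)
  define S where "S = {f \<in> faces T. c f = m}"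
  have "m \<in> c ` faces T"
    unfolding m_def using finite_faces faces_nonempty by (intro Max_in) auto
  then have "S \<noteq> {}" by (auto simp: S_def)
  have "S = faces T"
  proof (rule faces_edge_connected)
    show "S \<subseteq> faces T" "S \<noteq> {}" using \<open>S \<noteq> {}\<close> by (auto simp: S_def)
    fix f g e assume f': "f \<in> S" and g: "g \<in> faces T" and e: "e edge_of f" "e edge_of g"
    have f: "f \<in> faces T" "c f = m" using f' by (auto simp: S_def)
    show "g \<in> S"
    proof (cases "g = f")
      case False
      \<comment> \<open>The term for \<open>f\<close> is zero because \<open>c f = m\<close>, and in
        every other term neither factor is positive. A zero sum makes all terms vanish, and for a
        face sharing an edge with \<open>f\<close> the second factor is nonzero.\<close>
      let ?t = "\<lambda>h. (c h - m) * (area T f * face_matrix T f h)"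
      have "(\<Sum>h\<in>faces T. ?t h) = area T f * ((\<Sum>h\<in>faces T. c h * face_matrix T f h)
          - m * (\<Sum>h\<in>faces T. face_matrix T f h))"
        by (simp add: sum_distrib_left sum_subtractf[symmetric] algebra_simps)
      then have "(\<Sum>h\<in>faces T. ?t h) = 0" using ker[OF f(1)] sum_face_matrix_row[OF f(1)] by simp
      moreover have "?t h \<ge> 0" if "h \<in> faces T" for h
        using le[OF that] f(2) area_face_matrix[OF f(1), of h]
        by (cases "h = f") (auto simp: mult_nonpos_nonneg)
      ultimately have "?t g = 0" using sum_nonneg_eq_0_iff[OF finite_faces, of ?t] g by blast
      moreover have "card {e. e edge_of f \<and> e edge_of g} \<noteq> 0"
        using e finite_edges_face[OF f(1)] by (auto simp: card_eq_0_iff)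
      ultimately have "c g = m" using False area_face_matrix[OF f(1), of g] by auto
      then show ?thesis using g by (simp add: S_def)
    qed (use f' in simp)
  qed
  then show ?thesis by (auto simp: S_def)
qed

end

section \<open>The linear system and the dual basis\<close>

locale whitney_polytope_centre = whitney_polytope +
  fixes xs :: "real^3"
  assumes centre: "xs \<in> interior T"
begin

text \<open>The distance of \<open>xs\<close> from the plane of \<open>f\<close>; by
  \<open>height_eq\<close> the chosen point does not affect it.\<close>

definition height :: "(real^3) set \<Rightarrow> real" where
  "height f = ((SOME x. x \<in> f) - xs) \<bullet> normal T f"

lemma height_eq:
  assumes "f \<in> faces T" "x \<in> f"
  shows "(x - xs) \<bullet> normal T f = height f"
proof -
  have "(SOME x. x \<in> f) \<in> f" using assms(2) by (rule someI)
  from normal_const[OF assms(1) this assms(2)] show ?thesis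
    by (simp add: height_def inner_commute[of _ "normal T f"] inner_diff_right)
qed

lemma height_pos:
  assumes "f \<in> faces T"
  shows "height f > 0"
proof -
  obtain x where x: "x \<in> f" using face_nonempty[OF assms] by auto
  then show ?thesis
    using height_eq[OF assms x] normal_less_interior[OF assms x centre]
    by (simp add: inner_commute[of _ "normal T f"] inner_diff_right)
qed

text \<open>Weighting the equations by the areas and adding them removes the curls. What remains is
  \<open>a\<close> times the total flux of the radial field, which is positive because
  \<open>xs\<close> is interior; with \<open>a = 0\<close> only the kernel of the matrix is
  left.\<close>

lemma homogeneous_face_system:
  assumes hom: "\<And>f. f \<in> faces T \<Longrightarrow> a * height f + (\<Sum>g\<in>faces T. c g * face_matrix T f g) = 0"
  shows "a = 0" "\<exists>k. \<forall>g\<in>faces T. c g = k"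
proof -
  have "0 = (\<Sum>f\<in>faces T. area T f * (a * height f + (\<Sum>g\<in>faces T. c g * face_matrix T f g)))"
    using hom by simp
  also have "\<dots> = a * (\<Sum>f\<in>faces T. area T f * height f)
      + (\<Sum>f\<in>faces T. \<Sum>g\<in>faces T. c g * (area T f * face_matrix T f g))"
    by (simp add: distrib_left sum.distrib sum_distrib_left mult_ac)
  also have "(\<Sum>f\<in>faces T. \<Sum>g\<in>faces T. c g * (area T f * face_matrix T f g))
      = (\<Sum>g\<in>faces T. c g * (\<Sum>f\<in>faces T. area T f * face_matrix T f g))"
    by (subst sum.swap) (simp add: sum_distrib_left)
  also have "\<dots> = 0" using sum_face_matrix_column by simp
  finally have "a * (\<Sum>f\<in>faces T. area T f * height f) = 0" by simp
  moreover have "(\<Sum>f\<in>faces T. area T f * height f) > 0"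
    using finite_faces faces_nonempty area_pos height_pos by (intro sum_pos) auto
  ultimately show "a = 0" by simp
  with hom show "\<exists>k. \<forall>g\<in>faces T. c g = k" by (intro face_matrix_kernel) simp
qed

abbreviation field :: "real \<Rightarrow> ((real^3) set \<Rightarrow> real) \<Rightarrow> real^3 \<Rightarrow> real^3" where
  "field \<equiv> face_combination T n v lam C xs"

lemma field_trace:
  assumes "f \<in> faces T" "x \<in> f"
  shows "field a c x \<bullet> normal T f = a * height f + (\<Sum>g\<in>faces T. c g * face_matrix T f g)"
proof -
  have "x \<in> T" using assms face_subset by auto
  then show ?thesis
    using height_eq[OF assms] face_curl_trace[OF assms(1) _ assms(2)]
    by (simp add: face_combination_def sum_fun_apply inner_add_left inner_sum_left radial_field_def)
qed

text \<open>Zero traces leave only equal coefficients on the face fields, and those fields add up to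
  zero. Thus the traces on the frontier determine the field inside \<open>T\<close>.\<close>

lemma field_eq_0:
  assumes "\<And>f. f \<in> faces T \<Longrightarrow> a * height f + (\<Sum>g\<in>faces T. c g * face_matrix T f g) = 0"
  shows "field a c = 0"
proof -
  obtain k where "\<forall>g\<in>faces T. c g = k" and a: "a = 0" using homogeneous_face_system[OF assms] by blast
  then have "(\<Sum>g\<in>faces T. c g *\<^sub>R face_curl g) = k *\<^sub>R (\<Sum>g\<in>faces T. face_curl g)"
    by (simp add: scaleR_sum_right)
  then show ?thesis by (simp add: face_combination_def a sum_face_curl)
qed

lemma face_system_iff:
  "face_system T n v xs f a c \<longleftrightarrow>
    (\<forall>f'\<in>faces T. a * height f' + (\<Sum>g\<in>faces T. c g * face_matrix T f' g) = (if f = f' then 1 else 0))"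
proof
  assume sys: "face_system T n v xs f a c"
  show "\<forall>f'\<in>faces T. a * height f' + (\<Sum>g\<in>faces T. c g * face_matrix T f' g) = (if f = f' then 1 else 0)"
  proof
    fix f' assume f': "f' \<in> faces T"
    then obtain i where i: "i \<in> {1..n}" "v i \<in> f'" using face_vertex_exists by blast
    then show "a * height f' + (\<Sum>g\<in>faces T. c g * face_matrix T f' g) = (if f = f' then 1 else 0)"
      using sys f' height_eq[OF f' i(2)] unfolding face_system_def by metis
  qed
qed (simp add: face_system_def height_eq)

text \<open>Taking \<open>a\<close> to be the sum of the \<open>c g\<close> removes the one-dimensional kernel.\<close>

lemma face_system_solvable: "\<exists>a c. face_system T n v xs f a c"
proof -
  have sys: "(\<Sum>g\<in>faces T. c g * (height f' + face_matrix T f' g))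
      = (\<Sum>g\<in>faces T. c g) * height f' + (\<Sum>g\<in>faces T. c g * face_matrix T f' g)" for c f'
    by (simp add: distrib_left sum.distrib sum_distrib_right)
  have "\<exists>c. \<forall>f'\<in>faces T. (\<Sum>g\<in>faces T. c g * (height f' + face_matrix T f' g)) = (if f = f' then 1 else 0)"
  proof (rule finite_square_system_solvable[OF finite_faces])
    fix c assume "\<And>f'. f' \<in> faces T \<Longrightarrow> (\<Sum>g\<in>faces T. c g * (height f' + face_matrix T f' g)) = 0"
    then have hom: "(\<Sum>g\<in>faces T. c g) * height f' + (\<Sum>g\<in>faces T. c g * face_matrix T f' g) = 0"
      if "f' \<in> faces T" for f' using that sys by simp
    from homogeneous_face_system[OF hom] obtain k where k: "\<forall>g\<in>faces T. c g = k" "(\<Sum>g\<in>faces T. c g) = 0"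
      by blast
    then have "real (card (faces T)) * k = 0" by simp
    then have "k = 0" using finite_faces faces_nonempty by simp
    then show "\<forall>g\<in>faces T. c g = 0" using k by simp
  qed
  then show ?thesis unfolding face_system_iff sys by blast
qed

lemma M_Lambda2_eq: "M_Lambda2 T n v lam C xs = span (face_curl ` faces T \<union> {radial_field T xs})"
  unfolding M_Lambda2_def span_Un ..

lemma field_in_M_Lambda2: "field a c \<in> M_Lambda2 T n v lam C xs"
  unfolding M_Lambda2_eq face_combination_def
  by (intro span_add span_scale span_sum span_base) auto

text \<open>Linearity of \<open>field\<close> in its coefficients, in the form that subtracts the
  interpolant of the traces.\<close>

lemma field_comb:
  "field (a - (\<Sum>h\<in>faces T. t h * A h)) (\<lambda>g. c g - (\<Sum>h\<in>faces T. t h * d h g))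
    = field a c - (\<Sum>h\<in>faces T. t h *\<^sub>R field (A h) (d h))"
  by (simp only: face_combination_def sum_split_scaled)
    (simp add: scaleR_add_right sum.distrib scaleR_diff_left scaleR_sum_left)

lemma dual_basis:
  "(\<exists>q :: (real^3) set \<Rightarrow> real^3 \<Rightarrow> real^3.
            inj_on q (faces T) \<and> independent (q ` faces T) \<and>
            span (q ` faces T) = M_Lambda2 T n v lam C xs \<and>
            (\<forall>f\<in>faces T.
               (\<exists>a c. face_system T n v xs f a c) \<and>
               (\<forall>a c. face_system T n v xs f a c \<longrightarrow> q f = face_combination T n v lam C xs a c)) \<and>
            (\<forall>f\<in>faces T. \<forall>f'\<in>faces T. \<forall>x\<in>f'.
               q f x \<bullet> normal T f' = (if f = f' then 1 else 0)))
         \<and> dim (M_Lambda2 T n v lam C xs) = card (faces T)"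
proof -
  obtain A d where sys: "\<And>f. face_system T n v xs f (A f) (d f)"
    using face_system_solvable by metis
  define q where "q f = field (A f) (d f)" for f
  have q_trace: "q f x \<bullet> normal T f' = (if f = f' then 1 else 0)" if "f' \<in> faces T" "x \<in> f'" for f f' x
    using field_trace[OF that] sys[of f] that(1) by (auto simp: q_def face_system_iff)
  \<comment> \<open>Here \<open>t\<close> lists the normal traces of the field. Its difference from
    the combination of the \<open>q h\<close> has zero traces, so it vanishes by
    \<open>field_eq_0\<close>.\<close>
  have expand: "field a c = (\<Sum>h\<in>faces T. t h *\<^sub>R q h)"
    if t: "\<And>f. f \<in> faces T \<Longrightarrow> a * height f + (\<Sum>g\<in>faces T. c g * face_matrix T f g) = t f" for a c t
  proof -
    let ?a = "a - (\<Sum>h\<in>faces T. t h * A h)"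
    let ?c = "\<lambda>g. c g - (\<Sum>h\<in>faces T. t h * d h g)"
    have "field ?a ?c = 0"
    proof (rule field_eq_0)
      fix f assume f: "f \<in> faces T"
      then obtain x where x: "x \<in> f" using face_nonempty by blast
      have "?a * height f + (\<Sum>g\<in>faces T. ?c g * face_matrix T f g) = field ?a ?c x \<bullet> normal T f"
        using field_trace[OF f x] by simp
      also have "\<dots> = field a c x \<bullet> normal T f - (\<Sum>h\<in>faces T. t h * (q h x \<bullet> normal T f))"
        by (simp add: field_comb q_def sum_fun_apply inner_diff_left inner_sum_left)
      also have "\<dots> = t f - (\<Sum>h\<in>faces T. if h = f then t h else 0)"
        using field_trace[OF f x] t[OF f] q_trace[OF f x]
        by (simp add: if_distrib[of "\<lambda>r. _ * r"] cong: if_cong)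
      also have "\<dots> = 0" using f finite_faces by simp
      finally show "?a * height f + (\<Sum>g\<in>faces T. ?c g * face_matrix T f g) = 0" .
    qed
    then show ?thesis by (simp add: field_comb q_def)
  qed
  have inj: "inj_on q (faces T)"
  proof (rule inj_onI)
    fix f g assume fg: "f \<in> faces T" "g \<in> faces T" "q f = q g"
    obtain x where x: "x \<in> f" using face_nonempty fg by blast
    have "q g x \<bullet> normal T f = 1" using q_trace[OF fg(1) x, of f] unfolding fg(3) by simp
    then have "(if g = f then 1 else 0 :: real) = 1" unfolding q_trace[OF fg(1) x] .
    then show "f = g" by (metis zero_neq_one)
  qed
  have indep: "independent (q ` faces T)"
  proof
    assume "dependent (q ` faces T)"
    then obtain u where u: "\<exists>p\<in>q ` faces T. u p \<noteq> 0" "(\<Sum>p\<in>q ` faces T. u p *\<^sub>R p) = 0"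
      using dependent_finite[of "q ` faces T"] finite_faces by auto
    have zero: "(\<Sum>h\<in>faces T. u (q h) *\<^sub>R q h) = 0"
      using u(2) by (simp add: sum.reindex[OF inj] o_def)
    \<comment> \<open>The normal trace on \<open>f\<close> isolates the coefficient of
      \<open>q f\<close>.\<close>
    have "u (q f) = 0" if f: "f \<in> faces T" for f
    proof -
      obtain x where x: "x \<in> f" using face_nonempty f by blast
      have "(\<Sum>h\<in>faces T. u (q h) *\<^sub>R q h) x \<bullet> normal T f = (\<Sum>h\<in>faces T. if h = f then u (q h) else 0)"
        using q_trace[OF f x]
        by (simp add: sum_fun_apply inner_sum_left if_distrib[of "\<lambda>r. _ * r"] cong: if_cong)
      then show ?thesis using zero f finite_faces by simp
    qed
    then show False using u(1) by auto
  qed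
  have field_span: "field a c \<in> span (q ` faces T)" for a c
    by (subst expand[OF refl]) (intro span_sum span_scale span_base imageI)
  have span: "span (q ` faces T) = M_Lambda2 T n v lam C xs"
  proof
    show "span (q ` faces T) \<subseteq> M_Lambda2 T n v lam C xs"
      using field_in_M_Lambda2 unfolding M_Lambda2_eq
      by (intro span_minimal) (auto simp: q_def)
    have "face_curl g \<in> span (q ` faces T)" if "g \<in> faces T" for g
    proof -
      have "field 0 (\<lambda>h. if h = g then 1 else 0) = face_curl g"
        using that finite_faces
        by (simp add: face_combination_def if_distrib[of "\<lambda>r. r *\<^sub>R _"] cong: if_cong)
      then show ?thesis using field_span by metis
    qed
    moreover have "radial_field T xs \<in> span (q ` faces T)"
      using field_span[of 1 "\<lambda>_. 0"] by (simp add: face_combination_def)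
    ultimately show "M_Lambda2 T n v lam C xs \<subseteq> span (q ` faces T)"
      unfolding M_Lambda2_eq by (intro span_minimal) auto
  qed
  \<comment> \<open>Every solution of the system has the traces of \<open>q f\<close>, so its
    expansion has Kronecker coefficients and collapses to \<open>q f\<close>.\<close>
  have unique: "q f = field a c" if "f \<in> faces T" "face_system T n v xs f a c" for f a c
  proof -
    have "field a c = (\<Sum>h\<in>faces T. (if f = h then 1 else 0) *\<^sub>R q h)"
      using that(2) by (intro expand) (simp add: face_system_iff)
    then show ?thesis
      using that(1) finite_faces by (simp add: if_distrib[of "\<lambda>r. r *\<^sub>R _"] cong: if_cong)
  qed
  have dim: "dim (M_Lambda2 T n v lam C xs) = card (faces T)"
    unfolding span[symmetric] dim_span
    using dim_eq_card_independent[OF indep] card_image[OF inj] by simp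
  show ?thesis
  proof (intro conjI exI[of _ q] ballI allI impI)
    show "\<exists>a c. face_system T n v xs f a c" for f by (rule face_system_solvable)
    show "q f = field a c" if "f \<in> faces T" "face_system T n v xs f a c" for f a c
      using that by (rule unique)
    show "q f x \<bullet> normal T f' = (if f = f' then 1 else 0)" if "f' \<in> faces T" "x \<in> f'" for f f' x
      using that by (rule q_trace)
  qed (rule inj indep span dim)+
qed

end

theorem lemma4p6:
  fixes T :: "(real^3) set" and n :: nat and v :: "nat \<Rightarrow> real^3"
    and lam :: "nat \<Rightarrow> real^3 \<Rightarrow> real" and C :: "nat \<Rightarrow> nat \<Rightarrow> nat \<Rightarrow> real" and xs :: "real^3"
  assumes "polytope T" and "interior T \<noteq> {}"
    and "bij_betw v {1..n} {p. p extreme_point_of T}"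
    and "barycentric_coords T {1..n} v lam"
    and "coords_regular T n v lam"
    and "faces_regular T n v lam"
    and "inner_diagonal_coeffs T n v C"
    and "xs \<in> interior T"
  shows "(\<exists>q :: (real^3) set \<Rightarrow> real^3 \<Rightarrow> real^3.
            inj_on q (faces T) \<and> independent (q ` faces T) \<and>
            span (q ` faces T) = M_Lambda2 T n v lam C xs \<and>
            (\<forall>f\<in>faces T.
               (\<exists>a c. face_system T n v xs f a c) \<and>
               (\<forall>a c. face_system T n v xs f a c \<longrightarrow> q f = face_combination T n v lam C xs a c)) \<and>
            (\<forall>f\<in>faces T. \<forall>f'\<in>faces T. \<forall>x\<in>f'.
               q f x \<bullet> normal T f' = (if f = f' then 1 else 0)))
         \<and> dim (M_Lambda2 T n v lam C xs) = card (faces T)"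
proof -
  interpret whitney_polytope_centre T n v lam C xs
    by unfold_locales (use assms in auto)
  show ?thesis by (rule dual_basis)
qed

end
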